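(* Let $\mathcal{A}$ be a finite alphabet, let $\mathcal{W} \subseteq \mathcal{A}^+$ be a nonempty finite set of nonempty words and define $\langle\mathcal{W}\rangle = \min_{w\in\mathcal{W}}|w|$. Then there exists $\mathcal{B} \subseteq \mathcal{A}^{\langle\mathcal{W}\rangle}$ with $\#\mathcal{B} \leq 122(\# \mathcal{W})^7$ such that: if $x,x' \in \mathcal{A}^{\mathbb{Z}}$ are factorizable over $\mathcal{W}$, $x_{(-\infty,0)} = x'_{(-\infty,0)}$ and $x_0\neq x'_0$, then $x_{[-\langle \mathcal{W}\rangle,0)} \in \mathcal{B}$.
   Context: $\mathcal{A}^+$ is the set of nonempty finite words over $\mathcal{A}$, $\mathcal{A}^\ell$ is the set of words of length $\ell$, and $|w|$ is the length of $w$. For $x\in\mathcal{A}^{\mathbb{Z}}$, $x_{(-\infty,0)}$ is the left-infinite sequence $\cdots x_{-2}x_{-1}$ and $x_{[-m,0)}=x_{-m}\cdots x_{-1}$. A point $x\in\mathcal{A}^{\mathbb{Z}}$ is factorizable over $\mathcal{W}$ if there exist $y\in\mathcal{W}^{\mathbb{Z}}$ and $k\in\mathbb{Z}$ such that $x_{[k,\infty)}=y_0y_1y_2\cdots$ and $x_{(-\infty,k)}=\cdots y_{-3}y_{-2}y_{-1}$ (infinite concatenations). *)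

theory Defs
  imports Main
begin

definition words :: "'a set \<Rightarrow> nat \<Rightarrow> 'a list set" where
  "words A l = {w. set w \<subseteq> A \<and> length w = l}"

definition nonempty_words :: "'a set \<Rightarrow> 'a list set" where
  "nonempty_words A = {w. set w \<subseteq> A \<and> w \<noteq> []}"

definition min_length :: "'a list set \<Rightarrow> nat" where
  "min_length W = Min (length ` W)"

text \<open>The factor of \<open>x\<close> on the half-open interval from \<open>i\<close> (included) to \<open>j\<close> (excluded).\<close>

definition factor :: "(int \<Rightarrow> 'a) \<Rightarrow> int \<Rightarrow> int \<Rightarrow> 'a list" where
  "factor x i j = map x [i..j - 1]"

text \<open>
  The infinite concatenation \<open>y 0 @ y 1 @ ...\<close> is expressed through its finite partial
  concatenations, all of which must be read in \<open>x\<close> starting at \<open>k\<close>; symmetrically,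
  \<open>... @ y (- 2) @ y (- 1)\<close> must be read in \<open>x\<close> ending just before \<open>k\<close>. When all the words are
  nonempty, the lengths of the partial concatenations are unbounded, so that these conditions
  determine \<open>x\<close> on the whole half-line; this would fail with empty words.
\<close>

definition right_concat_at :: "(int \<Rightarrow> 'a) \<Rightarrow> int \<Rightarrow> (int \<Rightarrow> 'a list) \<Rightarrow> bool" where
  "right_concat_at x k y \<longleftrightarrow>
     (\<forall>n::nat. let u = concat (map y [0..int n - 1]) in factor x k (k + int (length u)) = u)"

definition left_concat_at :: "(int \<Rightarrow> 'a) \<Rightarrow> int \<Rightarrow> (int \<Rightarrow> 'a list) \<Rightarrow> bool" where
  "left_concat_at x k y \<longleftrightarrow>
     (\<forall>n::nat. let u = concat (map y [- int n..- 1]) in factor x (k - int (length u)) k = u)"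

definition factorizable :: "'a list set \<Rightarrow> (int \<Rightarrow> 'a) \<Rightarrow> bool" where
  "factorizable W x \<longleftrightarrow>
     (\<exists>y k. range y \<subseteq> W \<and> right_concat_at x k y \<and> left_concat_at x k y)"

end

theory Submission
  imports Defs "HOL-Library.Sublist"
begin

text \<open>
  Write \<open>n\<close> for the number of words. Two factorizable points with the same past and different
  letters at \<open>0\<close> give one left-infinite text with two parses into words of \<open>W\<close> that continue
  with different letters. Let \<open>L\<close> be the least length of a word, and call a word of length \<open>L\<close>
  branching if it ends such a text; the claim is that there are at most \<open>122 * n ^ 7\<close> branching
  words, and the proof gives at most \<open>121 * n ^ 6\<close>.

  For each branching word \<open>u\<close> take a branching in which the distance \<open>M\<close> from the chosen cuts of
  the two parses to the branching point is least. Minimality makes reading deterministic: after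
  a cut, if fewer than \<open>M\<close> letters remain before a branching point with past \<open>u\<close>, the next
  letter is forced. In such a branching one of the parses has a last word \<open>w\<close> that covers the
  last \<open>M\<close> letters, preceded by a word \<open>Y\<close>; the other parse either also has a cut at the start
  of \<open>w\<close>, followed by a word \<open>v\<close>, or has a word \<open>v\<close> that crosses the start of \<open>w\<close>
  (\<open>branching_types\<close>). There are \<open>n ^ 3\<close> triples \<open>(Y, w, v)\<close>, and in the first case a triple
  determines \<open>u\<close> (\<open>start_type_unique\<close>).

  In the second case fix the triple. The branching words then differ in the length \<open>s\<close> of the
  overlap of \<open>v\<close> with \<open>w\<close> and in the position \<open>M\<close> of the mismatch inside \<open>w\<close>. Two overlaps of
  lengths \<open>s < s'\<close> give the period \<open>s' - s\<close> of the prefix of \<open>w\<close> of length \<open>s'\<close>. By determinism,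
  the second parses of different branchings have no cut inside \<open>w\<close> in common. Many parses of one
  piece of text with pairwise disjoint cuts force a period: at each position two of more than
  \<open>n\<close> parses use the same word with different offsets, which is a local repetition, and the
  Critical Factorization Theorem turns local repetitions everywhere into a global period
  (\<open>periodic_of_disjoint_covers\<close>). If all the words used are short, so is the period.

  Consequently at most \<open>4 * n + 2\<close> overlaps end in one periodic run (\<open>overlaps_ending_in_run\<close>),
  so that every \<open>(4 * n + 2)\<close>-th overlap length forms a geometrically growing scale. If the
  scale had \<open>n * (8 * n + 12)\<close> steps, then, by the pigeonhole principle, no word would have its
  length in some \<open>8 * n + 12\<close> consecutive steps. Every word is then either short or long with
  respect to them, and \<open>n + 1\<close> parses at increasing scales, carried over to one prefix of \<open>w\<close>,
  compete for \<open>n\<close> words: two of them share a long word, or more of them than there are short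
  words cover one window by short words. Either way a run appears that covers a whole step of
  the scale, which is impossible (\<open>no_scale_gap\<close>). So each triple has at most
  \<open>(4 * n + 2) * (n * (8 * n + 12))\<close> branching words of the second kind, and summing over the
  triples gives the bound.
\<close>

section \<open>Local repetitions and periods\<close>

definition periodic_on :: "(nat \<Rightarrow> 'b) \<Rightarrow> nat \<Rightarrow> nat \<Rightarrow> nat \<Rightarrow> bool" where
  "periodic_on T A E q \<longleftrightarrow> (\<forall>y. A \<le> y \<and> y + q < E \<longrightarrow> T y = T (y + q))"

text \<open>
  This is the local repetition of combinatorics on words: the blocks of length \<open>g\<close> on the two
  sides of \<open>p\<close> may stick out of the interval from \<open>A\<close> to \<open>E\<close>, and are compared only where both
  copies of a letter lie in it.
\<close>
definition repetition_at :: "(nat \<Rightarrow> 'b) \<Rightarrow> nat \<Rightarrow> nat \<Rightarrow> nat \<Rightarrow> nat \<Rightarrow> bool" where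
  "repetition_at T A E p g \<longleftrightarrow>
     (\<forall>y. A \<le> y \<and> y < p \<and> p \<le> y + g \<and> y + g < E \<longrightarrow> T y = T (y + g))"

lemma maximal_suffix_exists:
  assumes "xs \<noteq> []" and tr: "trans r" and tot: "total r"
  shows "\<exists>v. v \<noteq> [] \<and> suffix v xs \<and>
    (\<forall>t. t \<noteq> [] \<longrightarrow> suffix t xs \<longrightarrow> t = v \<or> (t, v) \<in> lexord r)"
  using assms(1)
proof (induction xs)
  case Nil
  then show ?case by simp
next
  case (Cons x xs)
  show ?case
  proof (cases "xs = []")
    case True
    then show ?thesis by (intro exI[of _ "[x]"]) (auto simp: suffix_Cons)
  next
    case False
    then obtain v where v: "v \<noteq> []" "suffix v xs"
      "\<And>t. t \<noteq> [] \<Longrightarrow> suffix t xs \<Longrightarrow> t = v \<or> (t, v) \<in> lexord r"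
      using Cons.IH by blast
    have "(x # xs, v) \<in> lexord r \<or> x # xs = v \<or> (v, x # xs) \<in> lexord r"
      using lexord_linear[of r "x # xs" v] tot by (auto simp: total_on_def)
    then show ?thesis
    proof (elim disjE)
      assume "(v, x # xs) \<in> lexord r"
      then show ?thesis using v tr
        by (intro exI[of _ "x # xs"]) (auto simp: suffix_Cons dest: lexord_trans)
    next
      assume h: "(x # xs, v) \<in> lexord r"
      show ?thesis
      proof (intro exI[of _ v] conjI allI impI)
        fix t assume "t \<noteq> []" "suffix t (x # xs)"
        thus "t = v \<or> (t, v) \<in> lexord r" using v(3) h by (auto simp: suffix_Cons)
      qed (use v in \<open>auto simp: suffix_Cons\<close>)
    next
      assume h: "x # xs = v"
      hence "length (x # xs) \<le> length xs" using suffix_length_le[OF v(2)] by simp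
      thus ?thesis by simp
    qed
  qed
qed

lemma lexord_both_imp_prefix:
  assumes asym: "\<And>x y. (x, y) \<in> r \<Longrightarrow> (y, x) \<notin> r"
    and 1: "(t, v) \<in> lexord r" and 2: "(t, v) \<in> lexord (r\<inverse>)"
  shows "prefix t v"
  using 1 2
proof (induction t arbitrary: v)
  case Nil
  then show ?case by simp
next
  case (Cons a t)
  then obtain b w where v: "v = b # w" by (cases v) auto
  have "a = b" using Cons.prems asym unfolding v by auto
  then show ?case using Cons asym unfolding v by auto
qed

text \<open>
  This is the argument of Crochemore and Perrin. For an order and its reverse, take the maximal
  suffixes; the start of the shorter one, \<open>v\<close>, is a critical position. A repetition of length
  \<open>g\<close> there must reach over the start of the text, since otherwise \<open>v\<close> could be enlarged or
  replaced by a larger suffix. Then \<open>t = drop g v\<close> is smaller than \<open>v\<close> in both lexicographic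
  orders, in the reverse one because the longer suffix \<open>v'\<close> is maximal. Hence \<open>t\<close> is a prefix of
  \<open>v\<close>, and \<open>g\<close> is a period.
\<close>
lemma local_period_at_maximal_suffix:
  assumes tr: "trans r" and asym: "\<And>x y. (x, y) \<in> r \<Longrightarrow> (y, x) \<notin> r"
    and xs: "xs = u @ v" "u \<noteq> []" "v \<noteq> []"
    and max1: "\<And>t. t \<noteq> [] \<Longrightarrow> suffix t xs \<Longrightarrow> t = v \<or> (t, v) \<in> lexord r"
    and v': "suffix v v'" "suffix v' xs"
    and max2: "\<And>t. t \<noteq> [] \<Longrightarrow> suffix t xs \<Longrightarrow> t = v' \<or> (t, v') \<in> lexord (r\<inverse>)"
    and g: "g > 0" "\<And>y. y < length u \<Longrightarrow> length u \<le> y + g \<Longrightarrow> y + g < length xs \<Longrightarrow> xs ! y = xs ! (y + g)"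
    and y: "y + g < length xs"
  shows "xs ! y = xs ! (y + g)"
proof -
  have irr: "(w, w) \<notin> lexord r" for w
    by (rule lexord_irreflexive) (use asym in blast)
  have asyml: "(w, z) \<in> lexord r \<Longrightarrow> (z, w) \<notin> lexord r" for w z
    using irr[of w] lexord_trans[OF _ _ tr, of w z w] by blast
  have len: "length xs = length u + length v" using xs by simp
  \<comment> \<open>If the repetition lies inside \<open>u\<close> on the left, then \<open>z\<close>, the block before the critical
    position, can be put in front of \<open>v\<close> or cancelled from it, contradicting the maximality of
    \<open>v\<close>.\<close>
  have gu: "g > length u"
  proof (rule ccontr)
    assume "\<not> g > length u"
    hence gle: "g \<le> length u" by simp
    define z where "z = drop (length u - g) u"
    have zl: "length z = g" using gle by (simp add: z_def)
    have zne: "z \<noteq> []" using zl g(1) by auto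
    have uz: "u = take (length u - g) u @ z" by (simp add: z_def)
    have suf: "suffix (z @ v) xs" unfolding xs(1) using uz by (metis append.assoc suffix_def)
    have agree: "z ! k = v ! k" if "k < g" "k < length v" for k
    proof -
      have lt: "length u - g + k < length u" using that gle by linarith
      have "xs ! (length u - g + k) = xs ! (length u - g + k + g)"
        by (rule g(2)) (use that gle len in auto)
      moreover have "xs ! (length u - g + k) = z ! k"
        unfolding xs(1) nth_append z_def using lt gle by simp
      moreover have "length u - g + k + g = length u + k" using gle by simp
      hence "xs ! (length u - g + k + g) = v ! k" unfolding xs(1) by (simp only: nth_append_length_plus)
      ultimately show ?thesis by simp
    qed
    have zv: "z @ v = v \<or> (z @ v, v) \<in> lexord r" by (rule max1) (use suf zne in auto)
    hence zv: "(z @ v, v) \<in> lexord r" using zne by auto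
    show False
    proof (cases "g \<le> length v")
      case True
      define t where "t = drop g v"
      have v: "v = z @ t"
      proof -
        have "take g v = z" by (rule nth_equalityI) (use True zl agree in auto)
        thus ?thesis unfolding t_def by (metis append_take_drop_id)
      qed
      have "(v, t) \<in> lexord r"
        using zv asym unfolding v by (auto simp: lexord_same_pref_iff)
      moreover from this have "t \<noteq> []" by auto
      moreover have "suffix t xs" using v xs by (metis suffix_appendI suffix_def)
      ultimately have "t = v" using max1[of t] asyml by blast
      thus False using v zne by auto
    next
      case False
      have "take (length v) z = v" by (rule nth_equalityI) (use False zl agree in auto)
      hence z: "z = v @ drop (length v) z" by (metis append_take_drop_id)
      hence "z @ v = v @ (drop (length v) z @ v)" by (metis append.assoc)
      hence "(v, z @ v) \<in> lexord r" using xs(3)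
        by (metis append_is_Nil_conv lexord_append_rightI neq_Nil_conv)
      thus False using zv asyml by blast
    qed
  qed
  show ?thesis
  proof (cases "y < length u")
    case True
    thus ?thesis using g(2)[of y] gu y by simp
  next
    case False
    hence gv: "g < length v" using y len by simp
    define t where "t = drop g v"
    have tne: "t \<noteq> []" using gv by (simp add: t_def)
    have vt: "v = take g v @ t" by (simp add: t_def)
    have "suffix t v" using vt by (metis suffix_def)
    hence "suffix t xs" using xs by (simp add: suffix_appendI)
    hence t1: "(t, v) \<in> lexord r"
      using max1[of t] tne vt g(1) gv by (metis append_self_conv2 length_take less_not_refl list.size(3) min.absorb4)
    obtain y0 where y0: "v' = y0 @ v" using v'(1) by (auto simp: suffix_def)
    obtain u0 where u0: "u = u0 @ y0"
      using v'(2) y0 xs(1) by (auto simp: suffix_def)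
    \<comment> \<open>The repetition copies \<open>u\<close> to the end of \<open>take g v\<close>, so that \<open>y0 @ t\<close> occurs as a suffix
      and can be compared with \<open>v' = y0 @ v\<close>.\<close>
    have zu: "take g v = take (g - length u) v @ u"
    proof (rule nth_equalityI)
      fix k assume k: "k < length (take g v)"
      show "take g v ! k = (take (g - length u) v @ u) ! k"
      proof (cases "k < g - length u")
        case True
        thus ?thesis using k gv by (simp add: nth_append)
      next
        case False
        define j where "j = k - (g - length u)"
        have j: "j < length u" "k = g - length u + j" using False k gu gv by (auto simp: j_def)
        have "xs ! j = xs ! (j + g)" by (rule g(2)) (use j gu gv len in auto)
        moreover have "xs ! j = u ! j" using j xs by (simp add: nth_append)
        moreover have "xs ! (j + g) = v ! k"
        proof -
          have "j + g = length u + k" using j gu by linarith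
          thus ?thesis unfolding xs(1) by (simp only: nth_append_length_plus)
        qed
        moreover have "(take (g - length u) v @ u) ! k = u ! j"
        proof -
          have l: "length (take (g - length u) v) = g - length u" using gv by simp
          show ?thesis unfolding j(2) using nth_append_length_plus[of "take (g - length u) v" u j] l by simp
        qed
        moreover have "xs ! j = u ! j" using j xs by (simp add: nth_append)
        ultimately show ?thesis using k by simp
      qed
    qed (use gu gv in simp)
    have "v = (take (g - length u) v @ u0) @ (y0 @ t)" using vt zu u0 by (metis append.assoc)
    hence "suffix (y0 @ t) v" by (metis suffix_def)
    hence "suffix (y0 @ t) xs" using xs by (simp add: suffix_appendI)
    hence "y0 @ t = v' \<or> (y0 @ t, v') \<in> lexord (r\<inverse>)" using max2[of "y0 @ t"] tne by simp
    moreover have "y0 @ t \<noteq> v'" using y0 t1 irr by auto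
    ultimately have "(y0 @ t, y0 @ v) \<in> lexord (r\<inverse>)" using y0 by simp
    hence "(t, v) \<in> lexord (r\<inverse>)"
      by (rule lexord_append_leftD) (use asym in auto)
    hence "prefix t v" using t1 lexord_both_imp_prefix[of r t v] asym by blast
    then obtain t' where t': "v = t @ t'" by (auto simp: prefix_def)
    define k where "k = y - length u"
    have k: "y = length u + k" "k + g < length v" using False y len by (auto simp: k_def)
    have "xs ! y = v ! k" using k xs by (simp add: nth_append)
    also have "\<dots> = t ! k" using k t' by (metis add.commute less_diff_conv length_drop nth_append t_def)
    also have "\<dots> = v ! (k + g)" using k by (simp add: t_def add.commute)
    also have "\<dots> = xs ! (y + g)" using k xs by (simp add: nth_append)
    finally show ?thesis .
  qed
qed

lemma critical_factorization_nat:
  fixes xs :: "nat list"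
  assumes N: "N > 1"
    and loc: "\<And>p. 0 < p \<Longrightarrow> p < length xs \<Longrightarrow>
      \<exists>g. 0 < g \<and> g < N \<and> repetition_at ((!) xs) 0 (length xs) p g"
  shows "\<exists>q. 0 < q \<and> q < N \<and> periodic_on ((!) xs) 0 (length xs) q"
proof (cases "\<forall>y. y + 1 < length xs \<longrightarrow> xs ! y = xs ! (y + 1)")
  case True
  then show ?thesis using N by (intro exI[of _ 1]) (auto simp: periodic_on_def)
next
  case nonconst: False
  define r :: "(nat \<times> nat) set" where "r = {(x, y). x < y}"
  have r: "trans r" "total r" "\<And>x y. (x, y) \<in> r \<Longrightarrow> (y, x) \<notin> r"
    and r': "trans (r\<inverse>)" "total (r\<inverse>)" "\<And>x y. (x, y) \<in> r\<inverse> \<Longrightarrow> (y, x) \<notin> r\<inverse>"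
    by (auto simp: r_def trans_def total_on_def)
  have ne: "xs \<noteq> []" using nonconst by auto
  obtain v where v: "v \<noteq> []" "suffix v xs"
      "\<And>t. t \<noteq> [] \<Longrightarrow> suffix t xs \<Longrightarrow> t = v \<or> (t, v) \<in> lexord r"
    using maximal_suffix_exists[OF ne r(1,2)] by blast
  obtain v' where v': "v' \<noteq> []" "suffix v' xs"
      "\<And>t. t \<noteq> [] \<Longrightarrow> suffix t xs \<Longrightarrow> t = v' \<or> (t, v') \<in> lexord (r\<inverse>)"
    using maximal_suffix_exists[OF ne r'(1,2)] by blast
  \<comment> \<open>If the whole word were maximal for both orders, all letters would equal the first one.\<close>
  have notboth: "v \<noteq> xs \<or> v' \<noteq> xs"
  proof (rule ccontr)
    assume "\<not> ?thesis"
    hence eq: "v = xs" "v' = xs" by auto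
    obtain x l where xl: "xs = x # l" using ne by (cases xs) auto
    have "xs ! k = x" if k: "k < length xs" for k
    proof (cases k)
      case 0
      thus ?thesis by (simp add: xl)
    next
      case (Suc k')
      have dr: "drop k xs \<noteq> []" "suffix (drop k xs) xs" using k by (auto simp: suffix_drop)
      have hd: "drop k xs = xs ! k # drop (Suc k) xs" using k by (simp add: Cons_nth_drop_Suc)
      have "drop k xs \<noteq> xs"
      proof
        assume "drop k xs = xs"
        from arg_cong[OF this, of length] show False using k Suc by simp
      qed
      hence "(drop k xs, xs) \<in> lexord r" "(drop k xs, xs) \<in> lexord (r\<inverse>)"
        using v(3)[OF dr] v'(3)[OF dr] unfolding eq by auto
      hence "(xs ! k # drop (Suc k) xs, x # l) \<in> lexord r"
        "(xs ! k # drop (Suc k) xs, x # l) \<in> lexord (r\<inverse>)" unfolding hd using xl by simp_all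
      thus ?thesis by (auto simp: r_def lexord_cons_cons)
    qed
    thus False using nonconst by auto
  qed
  have cmp: "suffix v v' \<or> suffix v' v" using v(2) v'(2) by (metis suffix_same_cases)
  have main: "\<exists>q. 0 < q \<and> q < N \<and> periodic_on ((!) xs) 0 (length xs) q"
    if R: "trans R" "\<And>x y. (x, y) \<in> R \<Longrightarrow> (y, x) \<notin> R"
      and w: "w \<noteq> []" "suffix w xs" "\<And>t. t \<noteq> [] \<Longrightarrow> suffix t xs \<Longrightarrow> t = w \<or> (t, w) \<in> lexord R"
      and w': "suffix w' xs" "\<And>t. t \<noteq> [] \<Longrightarrow> suffix t xs \<Longrightarrow> t = w' \<or> (t, w') \<in> lexord (R\<inverse>)"
      and ww: "suffix w w'" "w \<noteq> xs" for R w w'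
  proof -
    obtain u where u: "xs = u @ w" using w(2) by (auto simp: suffix_def)
    have une: "u \<noteq> []" using ww(2) u by auto
    obtain g where g: "0 < g" "g < N" "repetition_at ((!) xs) 0 (length xs) (length u) g"
      using loc[of "length u"] u une w(1) by auto
    have "periodic_on ((!) xs) 0 (length xs) g"
      unfolding periodic_on_def
    proof (intro allI impI)
      fix y assume "0 \<le> y \<and> y + g < length xs"
      thus "xs ! y = xs ! (y + g)"
        using local_period_at_maximal_suffix[OF R u une w(1) w(3) ww(1) w' g(1), of y] g(3)
        by (auto simp: repetition_at_def)
    qed
    thus ?thesis using g by blast
  qed
  show ?thesis
  proof (cases "suffix v v'")
    case True
    have "v \<noteq> xs" using True notboth v'(2) suffix_order.antisym by blast
    thus ?thesis using main[of r v v'] r v v' True by blast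
  next
    case False
    hence s: "suffix v' v" using cmp by blast
    hence "v' \<noteq> xs" using notboth v(2) suffix_order.antisym by blast
    thus ?thesis using main[of "r\<inverse>" v' v] r' v v' s by (simp)
  qed
qed

text \<open>
  A form of the Critical Factorization Theorem. The letters of a finite interval can be
  numbered, so the statement for lists of numbers, where suffixes can be compared
  lexicographically, suffices.
\<close>
theorem critical_factorization:
  fixes T :: "nat \<Rightarrow> 'b"
  assumes N: "N > 1"
    and loc: "\<And>p. A < p \<Longrightarrow> p < E \<Longrightarrow> \<exists>g. 0 < g \<and> g < N \<and> repetition_at T A E p g"
  shows "\<exists>q. 0 < q \<and> q < N \<and> periodic_on T A E q"
proof -
  obtain f :: "'b \<Rightarrow> nat" and m where f: "inj_on f (T ` {A..<E})"
    using finite_imp_inj_to_nat_seg[of "T ` {A..<E}"] by auto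
  define xs where "xs = map (\<lambda>k. f (T k)) [A..<E]"
  have len: "length xs = E - A" by (simp add: xs_def)
  have nth: "xs ! k = f (T (A + k))" if "k < E - A" for k using that by (simp add: xs_def)
  have eq: "xs ! k = xs ! l \<longleftrightarrow> T (A + k) = T (A + l)" if "k < E - A" "l < E - A" for k l
    using that nth f by (auto simp: inj_on_def)
  have "\<exists>q. 0 < q \<and> q < N \<and> periodic_on ((!) xs) 0 (length xs) q"
  proof (rule critical_factorization_nat[OF N])
    fix p assume p: "0 < p" "p < length xs"
    obtain g where g: "0 < g" "g < N" "repetition_at T A E (A + p) g"
      using loc[of "A + p"] p len by (auto simp: less_diff_conv add.commute)
    have "repetition_at ((!) xs) 0 (length xs) p g"
      unfolding repetition_at_def
    proof (intro allI impI)
      fix y assume y: "0 \<le> y \<and> y < p \<and> p \<le> y + g \<and> y + g < length xs"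
      hence "T (A + y) = T (A + y + g)" using g(3) len unfolding repetition_at_def by auto
      thus "xs ! y = xs ! (y + g)" using eq[of y "y + g"] y len by (simp add: add.assoc)
    qed
    thus "\<exists>g. 0 < g \<and> g < N \<and> repetition_at ((!) xs) 0 (length xs) p g" using g by blast
  qed
  then obtain q where q: "0 < q" "q < N" "periodic_on ((!) xs) 0 (length xs) q" by blast
  have "periodic_on T A E q"
    unfolding periodic_on_def
  proof (intro allI impI)
    fix y assume y: "A \<le> y \<and> y + q < E"
    hence "y - A + q < length xs" using len by linarith
    hence "xs ! (y - A) = xs ! (y - A + q)" using q(3) unfolding periodic_on_def by blast
    moreover have "A + (y - A + q) = y + q" "y - A + q < E - A" "y - A < E - A" using y by linarith+
    ultimately show "T y = T (y + q)" using eq[of "y - A" "y - A + q"] y by simp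
  qed
  thus ?thesis using q by blast
qed

lemma periodic_on_mult:
  assumes "periodic_on T A E q" "A \<le> y" "y + k * q < E"
  shows "T y = T (y + k * q)"
  using assms(3)
proof (induction k)
  case (Suc k)
  hence "T y = T (y + k * q)" by simp
  also have "\<dots> = T (y + k * q + q)"
    using assms(1,2) Suc.prems unfolding periodic_on_def by (simp add: add.assoc add.commute)
  finally show ?case by (simp add: algebra_simps)
qed simp

lemma periodic_on_cong:
  assumes per: "periodic_on T A E q" and q: "0 < q"
    and "A \<le> x" "x < E" "A \<le> y" "y < E" "x mod q = y mod q"
  shows "T x = T y"
proof -
  have *: "T x = T y" if h: "x \<le> y" "A \<le> x" "y < E" "x mod q = y mod q" for x y
  proof -
    have "q dvd y - x" using h by (metis mod_eq_dvd_iff_nat)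
    then obtain k where k: "y - x = q * k" by blast
    hence yk: "y = x + k * q" using h by (simp add: mult.commute)
    show ?thesis using periodic_on_mult[OF per h(2), of k] h(3) unfolding yk by blast
  qed
  show ?thesis
  proof (cases "x \<le> y")
    case True
    then show ?thesis by (rule *) (use assms in auto)
  next
    case False
    then have "T y = T x" by (intro *) (use assms in auto)
    then show ?thesis by simp
  qed
qed

text \<open>
  A window of two periods contains a full period together with all its translates by less than
  \<open>q\<close>, so every equality \<open>T y = T (y + q')\<close> has a copy inside the window.
\<close>
lemma period_of_window:
  assumes per: "periodic_on T A E q" and q: "0 < q"
    and win: "A \<le> P" "P + 2 * q \<le> E" and q': "periodic_on T P E q'" "q' < q"
  shows "periodic_on T A E q'"
  unfolding periodic_on_def
proof (intro allI impI)
  fix y assume y: "A \<le> y \<and> y + q' < E"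
  \<comment> \<open>The first position of the window that is congruent to \<open>y\<close> modulo \<open>q\<close>.\<close>
  define x where "x = P + (y + (q - P mod q)) mod q"
  have x: "P \<le> x" "x < P + q" using q by (auto simp: x_def)
  have cong: "x mod q = y mod q"
  proof -
    have "x mod q = (P mod q + (y + (q - P mod q))) mod q"
      unfolding x_def by (simp only: mod_add_left_eq mod_add_right_eq)
    also have "P mod q + (y + (q - P mod q)) = y + q" using mod_less_divisor[OF q, of P] by linarith
    finally show ?thesis by simp
  qed
  have "T y = T x" by (rule periodic_on_cong[OF per q]) (use y x cong win in auto)
  also have "\<dots> = T (x + q')" using q' x win unfolding periodic_on_def by auto
  also have "\<dots> = T (y + q')"
  proof (rule periodic_on_cong[OF per q])
    show "(x + q') mod q = (y + q') mod q" using cong by (rule mod_add_cong) simp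
  qed (use y x win q' in auto)
  finally show "T y = T (y + q')" .
qed

text \<open>
  Otherwise the difference of the two positions modulo \<open>q\<close> would be a smaller period: a full
  period that reappears shifted determines the whole run.
\<close>
lemma equal_windows_cong:
  assumes per: "periodic_on T A E q" and q: "0 < q"
    and least: "\<And>q'. 0 < q' \<Longrightarrow> q' < q \<Longrightarrow> \<not> periodic_on T A E q'"
    and x: "A \<le> x" "x + q \<le> E" and x': "A \<le> x'" "x' + q \<le> E"
    and eq: "\<And>k. k < q \<Longrightarrow> T (x + k) = T (x' + k)"
  shows "x mod q = x' mod q"
proof (rule ccontr)
  assume ne: "x mod q \<noteq> x' mod q"
  have *: False if h: "A \<le> x" "x + q \<le> E" "A \<le> x'" "x' + q \<le> E" "x \<le> x'"
     "\<And>k. k < q \<Longrightarrow> T (x + k) = T (x' + k)" "x mod q \<noteq> x' mod q" for x x'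
  proof -
    define \<delta> where "\<delta> = (x' - x) mod q"
    have \<delta>: "0 < \<delta>" "\<delta> < q"
      using h(5,7) q mod_eq_dvd_iff_nat[OF h(5), of q] by (auto simp: \<delta>_def mod_greater_zero_iff_not_dvd)
    have x'\<delta>: "(x + \<delta>) mod q = x' mod q"
      using h(5) by (simp add: \<delta>_def mod_add_right_eq)
    have "periodic_on T A E \<delta>"
      unfolding periodic_on_def
    proof (intro allI impI)
      fix y assume y: "A \<le> y \<and> y + \<delta> < E"
      define k where "k = (y + (q - x mod q)) mod q"
      have k: "k < q" unfolding k_def by (rule mod_less_divisor[OF q])
      have cong: "(x + k) mod q = y mod q"
      proof -
        have "(x + k) mod q = (x mod q + (y + (q - x mod q))) mod q"
          unfolding k_def by (simp only: mod_add_left_eq mod_add_right_eq)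
        also have "x mod q + (y + (q - x mod q)) = y + q" using mod_less_divisor[OF q, of x] by linarith
        finally show ?thesis by simp
      qed
      have "T y = T (x + k)" by (rule periodic_on_cong[OF per q]) (use y h k cong in auto)
      also have "\<dots> = T (x' + k)" by (rule h(6)[OF k])
      also have "\<dots> = T (y + \<delta>)"
      proof (rule periodic_on_cong[OF per q])
        have "(x' + k) mod q = (x + \<delta> + k) mod q" using x'\<delta>[symmetric] by (rule mod_add_cong) simp
        also have "x + \<delta> + k = (x + k) + \<delta>" by simp
        also have "(x + k + \<delta>) mod q = (y + \<delta>) mod q" using cong by (rule mod_add_cong) simp
        finally show "(x' + k) mod q = (y + \<delta>) mod q" .
      qed (use y h k in auto)
      finally show "T y = T (y + \<delta>)" .
    qed
    thus False using least \<delta> by blast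
  qed
  show False
  proof (cases "x \<le> x'")
    case True
    show False by (rule *[OF x x' True eq ne])
  next
    case False
    show False by (rule *[OF x' x]) (use False eq ne in auto)
  qed
qed

section \<open>Disjoint parses force periodicity\<close>

lemma repetition_of_two_placements:
  assumes "\<gamma> < \<gamma>'" "\<gamma>' \<le> p" "p < \<gamma> + length v"
    and 1: "\<And>y. y < length v \<Longrightarrow> \<gamma> + y < E \<Longrightarrow> T (\<gamma> + y) = v ! y"
    and 2: "\<And>y. y < length v \<Longrightarrow> \<gamma>' + y < E \<Longrightarrow> T (\<gamma>' + y) = v ! y"
  shows "repetition_at T A E p (\<gamma>' - \<gamma>)"
  unfolding repetition_at_def
proof (intro allI impI)
  fix y assume y: "A \<le> y \<and> y < p \<and> p \<le> y + (\<gamma>' - \<gamma>) \<and> y + (\<gamma>' - \<gamma>) < E"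
  define k where "k = y - \<gamma>"
  have k: "y = \<gamma> + k" "y + (\<gamma>' - \<gamma>) = \<gamma>' + k" "k < length v"
    using y assms(1-3) unfolding k_def by linarith+
  have "\<gamma> + k < E" "\<gamma>' + k < E" using y k(1,2) by linarith+
  thus "T y = T (y + (\<gamma>' - \<gamma>))" unfolding k(1) using 1[OF k(3)] 2[OF k(3)] k(1,2) by metis
qed

text \<open>
  At each position there are more parses, indexed by \<open>J\<close>, than words in \<open>V\<close>, so two of them use
  the same word there; since their sets of cuts \<open>D\<close> are disjoint, they place it at different
  offsets, and this is a local repetition. The bound \<open>N\<close> on the part of each word that lies to
  the left of the position bounds the length of the repetition. Words may run over \<open>E\<close>, and only
  their letters before \<open>E\<close> matter.
\<close>
lemma periodic_of_disjoint_covers: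
  fixes T :: "nat \<Rightarrow> 'b" and V :: "'b list set" and J :: "'j set"
  assumes V: "finite V" "card V < card J" and AE: "A + 1 < E"
    and disj: "\<And>i j. i \<in> J \<Longrightarrow> j \<in> J \<Longrightarrow> i \<noteq> j \<Longrightarrow> D i \<inter> D j = {}"
    and cover: "\<And>i p. i \<in> J \<Longrightarrow> A < p \<Longrightarrow> p < E \<Longrightarrow>
      \<exists>\<gamma>\<in>D i. \<exists>v\<in>V. \<gamma> \<le> p \<and> p < \<gamma> + length v \<and> p - \<gamma> < N \<and>
        (\<forall>y<length v. \<gamma> + y < E \<longrightarrow> T (\<gamma> + y) = v ! y)"
  shows "\<exists>q. 0 < q \<and> q < N \<and> periodic_on T A E q"
proof -
  have loc: "\<exists>g. 0 < g \<and> g < N \<and> repetition_at T A E p g" if p: "A < p" "p < E" for p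
  proof -
    have "\<forall>i\<in>J. \<exists>\<gamma> v. \<gamma> \<in> D i \<and> v \<in> V \<and> \<gamma> \<le> p \<and> p < \<gamma> + length v \<and> p - \<gamma> < N \<and>
        (\<forall>y<length v. \<gamma> + y < E \<longrightarrow> T (\<gamma> + y) = v ! y)"
      using cover p by blast
    then obtain \<gamma> v where \<gamma>v: "\<And>i. i \<in> J \<Longrightarrow> \<gamma> i \<in> D i \<and> v i \<in> V \<and> \<gamma> i \<le> p \<and>
        p < \<gamma> i + length (v i) \<and> p - \<gamma> i < N \<and>
        (\<forall>y<length (v i). \<gamma> i + y < E \<longrightarrow> T (\<gamma> i + y) = v i ! y)"
      by metis
    have "card (v ` J) \<le> card V" by (rule card_mono) (use V \<gamma>v in auto)
    hence "\<not> inj_on v J" using V(2) pigeonhole by (metis le_less_trans)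
    then obtain i j where ij: "i \<in> J" "j \<in> J" "i \<noteq> j" "v i = v j" by (auto simp: inj_on_def)
    have ne: "\<gamma> i \<noteq> \<gamma> j" using disj[OF ij(1-3)] \<gamma>v[OF ij(1)] \<gamma>v[OF ij(2)] by auto
    have main: "\<exists>g. 0 < g \<and> g < N \<and> repetition_at T A E p g"
      if h: "i \<in> J" "j \<in> J" "v i = v j" "\<gamma> i < \<gamma> j" for i j
    proof (intro exI conjI)
      show "0 < \<gamma> j - \<gamma> i" using h by simp
      show "\<gamma> j - \<gamma> i < N" using \<gamma>v[OF h(1)] \<gamma>v[OF h(2)] by linarith
      show "repetition_at T A E p (\<gamma> j - \<gamma> i)"
        by (rule repetition_of_two_placements[of _ _ _ "v i"])
          (use \<gamma>v[OF h(1)] \<gamma>v[OF h(2)] h in auto)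
    qed
    show ?thesis using main[of i j] main[of j i] ij ne by (metis linorder_neqE_nat)
  qed
  have "N > 1" using loc[of "A + 1"] AE by auto
  thus ?thesis using critical_factorization[of N A E T] loc by blast
qed

section \<open>Overlaps ending in one periodic run\<close>

text \<open>
  All that the count needs to know about the branchings in which a word \<open>Y\<close> of the second parse
  crosses the start of the last word \<open>w\<close> of the first parse, for fixed \<open>Y\<close> and \<open>w\<close>. In the
  branching with index \<open>i\<close>, the last \<open>s i\<close> letters of \<open>Y\<close> are the first \<open>s i\<close> letters of \<open>w\<close>,
  and the branching point is at position \<open>d i\<close> of \<open>w\<close>.

  The set \<open>C i\<close> consists of cuts of the second parse, as positions in \<open>w\<close>; each is followed by a
  word that agrees with \<open>w\<close> up to \<open>d i\<close>. The set \<open>K i\<close> consists of cuts of the first parse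
  inside \<open>Y\<close>, as distances from the right end of \<open>Y\<close>; each is preceded by a word that agrees
  with \<open>Y\<close>, and the smallest, \<open>s i\<close>, is the start of \<open>w\<close>. Distances from the right are natural
  here because \<open>Y\<close> has a fixed right end, \<open>w\<close> a fixed left end, and the overlap \<open>s i\<close> changes
  with \<open>i\<close>.

  The conditions \<open>C_disjoint\<close>, \<open>mismatch\<close> and \<open>no_transport\<close> are the forms in which determinism
  of least branchings is used. In \<open>mismatch\<close>, the texts of \<open>w\<close> from \<open>s i\<close> to the branching point
  of \<open>i\<close> and from \<open>s j\<close> on differ. In \<open>no_transport\<close>, the cuts of the first parses \<open>k\<close> and \<open>l\<close>
  are carried over from \<open>Y\<close> to the position \<open>\<gamma>\<close> of \<open>w\<close>, through the overlaps \<open>s j\<close> and \<open>s i\<close>.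
\<close>
locale overlap_family =
  fixes W :: "'a list set" and w Y :: "'a list" and I :: "'i set"
    and s d :: "'i \<Rightarrow> nat" and C K :: "'i \<Rightarrow> nat set"
  assumes fin: "finite W" and nonempty: "[] \<notin> W" and wW: "w \<in> W" and YW: "Y \<in> W"
    and finI: "finite I"
    and s_le_d: "i \<in> I \<Longrightarrow> s i \<le> d i"
    and d_less: "i \<in> I \<Longrightarrow> d i < length w"
    and s_less: "i \<in> I \<Longrightarrow> s i < length Y"
    and border: "i \<in> I \<Longrightarrow> y < s i \<Longrightarrow> w ! y = rev Y ! (s i - 1 - y)"
    and inj_s: "inj_on s I" and inj_d: "inj_on d I"
    and C_start: "i \<in> I \<Longrightarrow> s i \<in> C i"
    and C_bounds: "i \<in> I \<Longrightarrow> \<kappa> \<in> C i \<Longrightarrow> s i \<le> \<kappa>"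
    and C_step: "i \<in> I \<Longrightarrow> \<kappa> \<in> C i \<Longrightarrow>
      \<exists>v\<in>W. (\<forall>y<length v. \<kappa> + y < d i \<longrightarrow> w ! (\<kappa> + y) = v ! y) \<and>
        (\<kappa> + length v \<le> d i \<longrightarrow> \<kappa> + length v \<in> C i)"
    and C_disjoint: "i \<in> I \<Longrightarrow> j \<in> I \<Longrightarrow> i \<noteq> j \<Longrightarrow> C i \<inter> C j = {}"
    and mismatch: "i \<in> I \<Longrightarrow> j \<in> I \<Longrightarrow> i \<noteq> j \<Longrightarrow> s j + (d i - s i) < length w \<Longrightarrow>
      \<exists>y\<le>d i - s i. w ! (s i + y) \<noteq> w ! (s j + y)"
    and K_start: "i \<in> I \<Longrightarrow> s i \<in> K i"
    and K_bounds: "i \<in> I \<Longrightarrow> x \<in> K i \<Longrightarrow> s i \<le> x"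
    and K_step: "i \<in> I \<Longrightarrow> x \<in> K i \<Longrightarrow>
      \<exists>v\<in>W. (\<forall>y<length v. x + y < length Y \<longrightarrow> rev Y ! (x + y) = rev v ! y) \<and>
        (x + length v \<le> length Y \<longrightarrow> x + length v \<in> K i)"
    and no_transport: "i \<in> I \<Longrightarrow> j \<in> I \<Longrightarrow> k \<in> I \<Longrightarrow> l \<in> I \<Longrightarrow> d i < s j \<Longrightarrow> 0 < \<gamma> \<Longrightarrow> \<gamma> \<le> s i \<Longrightarrow>
      s j - \<gamma> \<in> K k \<Longrightarrow> s i - \<gamma> \<in> K l \<Longrightarrow> False"
begin

abbreviation "n \<equiv> card W"

lemma chain_cover:
  fixes c :: "nat set"
  assumes "a \<in> c" "a \<le> p" "p < e"
    and step: "\<And>\<kappa>. \<kappa> \<in> c \<Longrightarrow> \<exists>v\<in>W. P \<kappa> v \<and> (\<kappa> + length v \<le> e \<longrightarrow> \<kappa> + length v \<in> c)"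
  shows "\<exists>\<gamma>\<in>c. \<exists>v\<in>W. \<gamma> \<le> p \<and> p < \<gamma> + length v \<and> P \<gamma> v \<and> (\<gamma> + length v \<le> e \<longrightarrow> \<gamma> + length v \<in> c)"
proof -
  \<comment> \<open>The last cut up to \<open>p\<close>; if its word ended by \<open>p\<close>, the end would be a later one.\<close>
  define \<gamma> where "\<gamma> = Max {\<gamma> \<in> c. \<gamma> \<le> p}"
  have fin': "finite {\<gamma> \<in> c. \<gamma> \<le> p}" by (rule finite_subset[of _ "{..p}"]) auto
  have "\<gamma> \<in> {\<gamma> \<in> c. \<gamma> \<le> p}" unfolding \<gamma>_def by (rule Max_in[OF fin']) (use assms in auto)
  hence \<gamma>: "\<gamma> \<in> c" "\<gamma> \<le> p" by auto
  obtain v where v: "v \<in> W" "P \<gamma> v" "\<gamma> + length v \<le> e \<longrightarrow> \<gamma> + length v \<in> c"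
    using step[OF \<gamma>(1)] by blast
  have "p < \<gamma> + length v"
  proof (rule ccontr)
    assume "\<not> p < \<gamma> + length v"
    hence "\<gamma> + length v \<in> {\<gamma> \<in> c. \<gamma> \<le> p}" using v assms(3) by auto
    hence "\<gamma> + length v \<le> \<gamma>" using Max_ge[OF fin'] unfolding \<gamma>_def by blast
    thus False using v(1) nonempty by auto
  qed
  thus ?thesis using \<gamma> v by blast
qed

lemma C_cover:
  assumes "i \<in> I" "s i \<le> p" "p < d i"
  shows "\<exists>\<gamma>\<in>C i. \<exists>v\<in>W. \<gamma> \<le> p \<and> p < \<gamma> + length v \<and>
    (\<forall>y<length v. \<gamma> + y < d i \<longrightarrow> w ! (\<gamma> + y) = v ! y) \<and>
    (\<gamma> + length v \<le> d i \<longrightarrow> \<gamma> + length v \<in> C i)"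
  by (rule chain_cover[OF C_start]) (use assms C_step in auto)

lemma K_cover:
  assumes "i \<in> I" "s i \<le> p" "p < length Y"
  shows "\<exists>\<gamma>\<in>K i. \<exists>v\<in>W. \<gamma> \<le> p \<and> p < \<gamma> + length v \<and>
    (\<forall>y<length v. \<gamma> + y < length Y \<longrightarrow> rev Y ! (\<gamma> + y) = rev v ! y) \<and>
    (\<gamma> + length v \<le> length Y \<longrightarrow> \<gamma> + length v \<in> K i)"
  by (rule chain_cover[OF K_start]) (use assms K_step in auto)

text \<open>
  The prefixes of \<open>w\<close> of lengths \<open>s i\<close> and \<open>s j\<close> are both suffixes of \<open>Y\<close>, so the shorter is a
  border of the longer.
\<close>
lemma border_period:
  assumes "i \<in> I" "j \<in> I" "s i \<le> s j"
  shows "periodic_on ((!) w) 0 (s j) (s j - s i)"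
  unfolding periodic_on_def
proof (intro allI impI)
  fix y assume y: "0 \<le> y \<and> y + (s j - s i) < s j"
  have "w ! y = rev Y ! (s i - 1 - y)" by (rule border) (use y assms in auto)
  also have "s i - 1 - y = s j - 1 - (y + (s j - s i))" using y assms by auto
  also have "rev Y ! \<dots> = w ! (y + (s j - s i))" by (rule border[symmetric]) (use y assms in auto)
  finally show "w ! y = w ! (y + (s j - s i))" .
qed

text \<open>
  Extend the run as far to the right as its least period \<open>q\<close> allows, up to \<open>E\<close>. All the overlaps
  end in the same phase modulo \<open>q\<close>, because the last \<open>q\<close> letters of \<open>Y\<close> precede each of these
  ends.

  Overlaps whose branching point \<open>d\<close> lies in the run see the same text after their ends, so that
  \<open>mismatch\<close> allows only one, and \<open>d = E\<close> is possible only once. For \<open>d\<close> beyond \<open>E\<close>, consider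
  the words by which the second parse reads the end of the run. A word that crosses \<open>E\<close> with at
  least \<open>q\<close> letters before it sees the break of the period, and therefore has a fixed position;
  a word with at least \<open>q\<close> letters that ends near \<open>E\<close> has a fixed phase. Disjointness of the
  cuts allows each word at most three such uses in total, two of them being ends near \<open>E\<close>. The
  remaining second parses cover the last \<open>2 * q\<close> letters of the run with words that reach back
  by less than \<open>q\<close>, and more than \<open>n\<close> of them would force a period smaller than \<open>q\<close>.
\<close>
lemma overlaps_ending_in_run:
  assumes per0: "periodic_on ((!) w) A E0 q0" "0 < q0" and E0: "E0 \<le> length w"
    and J: "J \<subseteq> I" "\<And>i. i \<in> J \<Longrightarrow> A + 2 * q0 \<le> s i \<and> s i \<le> E0"
  shows "card J \<le> 4 * n + 2"
proof (cases "J = {}")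
  case False
  have finJ: "finite J" using J(1) finI by (rule finite_subset)
  define q where "q = (LEAST q. 0 < q \<and> periodic_on ((!) w) A E0 q)"
  have q: "0 < q" "periodic_on ((!) w) A E0 q"
    using LeastI[of "\<lambda>q. 0 < q \<and> periodic_on ((!) w) A E0 q" q0] per0 unfolding q_def by auto
  have qq0: "q \<le> q0" unfolding q_def by (rule Least_le) (use per0 in auto)
  have least0: "\<not> periodic_on ((!) w) A E0 q'" if "0 < q'" "q' < q" for q'
    using not_less_Least[of q' "\<lambda>q. 0 < q \<and> periodic_on ((!) w) A E0 q"] that unfolding q_def by blast
  define R where "R = {E. E \<le> length w \<and> periodic_on ((!) w) A E q}"
  define E where "E = Max R"
  have finR: "finite R" by (rule finite_subset[of _ "{..length w}"]) (auto simp: R_def)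
  have E0R: "E0 \<in> R" using E0 q by (simp add: R_def)
  have "E \<in> R" unfolding E_def by (rule Max_in[OF finR]) (use E0R in auto)
  hence E: "E \<le> length w" "periodic_on ((!) w) A E q" by (auto simp: R_def)
  have E0E: "E0 \<le> E" unfolding E_def by (rule Max_ge[OF finR E0R])
  have least: "\<not> periodic_on ((!) w) A E q'" if "0 < q'" "q' < q" for q'
    using least0[OF that] E0E unfolding periodic_on_def by (meson less_le_trans)
  have sJ: "A + 2 * q \<le> s i" "s i \<le> E" if "i \<in> J" for i using J(2)[OF that] qq0 E0E by auto
  have AE: "A + 2 * q \<le> E" using False sJ by (metis ex_in_conv le_trans)
  \<comment> \<open>The run cannot be extended.\<close>
  have brk: "w ! E \<noteq> w ! (E - q)" if "E < length w"
  proof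
    assume eq: "w ! E = w ! (E - q)"
    have "periodic_on ((!) w) A (E + 1) q"
      unfolding periodic_on_def
    proof (intro allI impI)
      fix y assume y: "A \<le> y \<and> y + q < E + 1"
      show "w ! y = w ! (y + q)"
      proof (cases "y + q = E")
        case True
        hence "y = E - q" by simp
        thus ?thesis using eq True by simp
      next
        case False
        thus ?thesis using E(2) y unfolding periodic_on_def by auto
      qed
    qed
    hence "E + 1 \<in> R" using that by (simp add: R_def)
    hence "E + 1 \<le> E" unfolding E_def by (rule Max_ge[OF finR])
    thus False by simp
  qed
  have cong: "w ! x = w ! y" if "A \<le> x" "x < E" "A \<le> y" "y < E" "x mod q = y mod q" for x y
    by (rule periodic_on_cong[OF E(2) q(1) that])
  have phase: "h mod q = h' mod q"
    if h: "A + q \<le> h" "h \<le> E" and h': "A + q \<le> h'" "h' \<le> E"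
      and eq: "\<And>k. k < q \<Longrightarrow> w ! (h - q + k) = w ! (h' - q + k)" for h h'
  proof -
    have "(h - q) mod q = (h' - q) mod q"
      by (rule equal_windows_cong[OF E(2) q(1) least]) (use h h' eq in auto)
    thus ?thesis using h h' by (simp add: le_mod_geq)
  qed
  have s_phase: "s i mod q = s j mod q" if ij: "i \<in> J" "j \<in> J" for i j
  proof (rule phase)
    fix k assume k: "k < q"
    have *: "w ! (s i - q + k) = rev Y ! (q - 1 - k)" if "i \<in> J" for i
    proof -
      have "w ! (s i - q + k) = rev Y ! (s i - 1 - (s i - q + k))"
        by (rule border) (use J(1) that sJ[OF that] k in auto)
      also have "s i - 1 - (s i - q + k) = q - 1 - k" using sJ[OF that] k by auto
      finally show ?thesis .
    qed
    show "w ! (s i - q + k) = w ! (s j - q + k)" using * ij by simp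
  qed (use sJ[OF ij(1)] sJ[OF ij(2)] in auto)

  define J1 where "J1 = {i \<in> J. d i < E}"
  define J2 where "J2 = {i \<in> J. d i = E}"
  define J3 where "J3 = {i \<in> J. E < d i}"
  have c1: "card J1 \<le> 1"
  proof -
    have "i = j" if ij: "i \<in> J1" "j \<in> J1" for i j
    proof (rule ccontr)
      assume ne: "i \<noteq> j"
      have main: False if h: "i \<in> J1" "j \<in> J1" "i \<noteq> j" "s i < s j" for i j
      proof -
        have IJ: "i \<in> I" "j \<in> I" "i \<in> J" "j \<in> J" "d i < E" "d j < E" using h J(1) by (auto simp: J1_def)
        have lt: "s i + (d j - s j) < length w" using h(4) IJ s_le_d[of j] E(1) by linarith
        obtain y where y: "y \<le> d j - s j" "w ! (s j + y) \<noteq> w ! (s i + y)"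
          using mismatch[OF IJ(2,1) h(3)[symmetric] lt] by blast
        have "w ! (s j + y) = w ! (s i + y)"
          by (rule cong) (use y(1) IJ h(4) s_le_d[of j] sJ[OF IJ(3)] sJ[OF IJ(4)] s_phase[OF IJ(3,4)]
              in \<open>auto intro: mod_add_cong\<close>)
        thus False using y(2) by simp
      qed
      have "s i \<noteq> s j" using ne ij J(1) inj_s by (auto simp: J1_def inj_on_def)
      thus False using main[OF ij ne] main[OF ij(2,1) ne[symmetric]] by (rule linorder_neqE_nat)
    qed
    moreover have "finite J1" using finJ by (simp add: J1_def)
    ultimately show ?thesis by (simp add: card_le_Suc0_iff_eq)
  qed
  have c2: "card J2 \<le> 1"
  proof -
    have "i = j" if ij: "i \<in> J2" "j \<in> J2" for i j
      using that J(1) inj_d by (auto simp: J2_def inj_on_def)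
    moreover have "finite J2" using finJ by (simp add: J2_def)
    ultimately show ?thesis by (simp add: card_le_Suc0_iff_eq)
  qed
  have J3: "i \<in> I" "i \<in> J" "E < d i" "E < length w" if "i \<in> J3" for i
    using that J(1) d_less[of i] by (auto simp: J3_def)

  \<comment> \<open>Parses with a word that crosses the end of the run and has at least \<open>q\<close> letters in it.\<close>
  define Ja where "Ja = {i \<in> J3. \<exists>\<gamma>\<in>C i. \<exists>v\<in>W. \<gamma> + q \<le> E \<and> E < \<gamma> + length v \<and>
    (\<forall>y<length v. \<gamma> + y < d i \<longrightarrow> w ! (\<gamma> + y) = v ! y)}"
  have ca: "card Ja \<le> n"
  proof -
    have "\<forall>i\<in>Ja. \<exists>\<gamma> v. \<gamma> \<in> C i \<and> v \<in> W \<and> \<gamma> + q \<le> E \<and> E < \<gamma> + length v \<and>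
      (\<forall>y<length v. \<gamma> + y < d i \<longrightarrow> w ! (\<gamma> + y) = v ! y)" by (auto simp: Ja_def)
    then obtain \<gamma> v where \<gamma>v: "\<And>i. i \<in> Ja \<Longrightarrow> \<gamma> i \<in> C i \<and> v i \<in> W \<and> \<gamma> i + q \<le> E \<and>
      E < \<gamma> i + length (v i) \<and> (\<forall>y<length (v i). \<gamma> i + y < d i \<longrightarrow> w ! (\<gamma> i + y) = v i ! y)"
      by metis
    \<comment> \<open>The letter that the word of \<open>i\<close> puts at \<open>E\<close> lies inside the run in the earlier placement
      by \<open>j\<close>, where it equals the letter \<open>q\<close> places before; so the period would not break at
      \<open>E\<close>.\<close>
    have main: False if h: "i \<in> Ja" "j \<in> Ja" "v i = v j" "\<gamma> j < \<gamma> i" for i j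
    proof -
      have hi: "i \<in> J3" "j \<in> J3" using h by (auto simp: Ja_def)
      note i = J3[OF hi(1)] and j = J3[OF hi(2)]
      define r where "r = E - \<gamma> i"
      have r: "q \<le> r" "\<gamma> i + r = E" "r < length (v i)" "\<gamma> j + r < E"
        using \<gamma>v[OF h(1)] h(4) unfolding r_def by linarith+
      have "w ! E = v i ! r" using \<gamma>v[OF h(1)] r i by metis
      also have "\<dots> = w ! (\<gamma> j + r)" using \<gamma>v[OF h(2)] r j h(3) by (metis less_trans)
      also have "\<dots> = w ! (\<gamma> j + (r - q))"
      proof (rule cong)
        show "A \<le> \<gamma> j + (r - q)" "A \<le> \<gamma> j + r"
          using C_bounds[OF j(1)] \<gamma>v[OF h(2)] sJ[OF j(2)] by force+
        have "\<gamma> j + r = (\<gamma> j + (r - q)) + q" using r by simp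
        thus "(\<gamma> j + r) mod q = (\<gamma> j + (r - q)) mod q" by (metis mod_add_self2)
      qed (use r in auto)
      also have "\<dots> = v i ! (r - q)"
      proof -
        have "r - q < length (v j)" "\<gamma> j + (r - q) < d j" using r j h(3) by auto
        thus ?thesis using \<gamma>v[OF h(2)] h(3) by metis
      qed
      also have "\<dots> = w ! (\<gamma> i + (r - q))"
      proof -
        have "r - q < length (v i)" "\<gamma> i + (r - q) < d i" using r i by auto
        thus ?thesis using \<gamma>v[OF h(1)] by metis
      qed
      also have "\<gamma> i + (r - q) = E - q" using r by auto
      finally show False using brk[OF i(4)] by simp
    qed
    have "inj_on v Ja"
    proof (rule inj_onI, rule ccontr)
      fix i j assume h: "i \<in> Ja" "j \<in> Ja" "v i = v j" "i \<noteq> j"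
      have "i \<in> I" "j \<in> I" using h J3 by (auto simp: Ja_def)
      hence "\<gamma> i \<noteq> \<gamma> j" using C_disjoint[of i j] h \<gamma>v[OF h(1)] \<gamma>v[OF h(2)] by auto
      thus False using main[of i j] main[of j i] h by (metis linorder_neqE_nat)
    qed
    thus ?thesis by (rule card_inj_on_le) (use \<gamma>v fin in auto)
  qed

  \<comment> \<open>Parses with a cut among the last \<open>2 * q\<close> positions of the run that follows at least \<open>q\<close>
    letters of one word.\<close>
  define Jb where "Jb = {i \<in> J3. \<exists>h\<in>C i. \<exists>v\<in>W. E < h + 2 * q \<and> h \<le> E \<and> q \<le> length v \<and>
    (\<forall>k<q. w ! (h - q + k) = v ! (length v - q + k))}"
  have JbI: "i \<in> Jb" if "i \<in> J3" "h \<in> C i" "v \<in> W" "E < h + 2 * q" "h \<le> E" "q \<le> length v"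
    "\<And>k. k < q \<Longrightarrow> w ! (h - q + k) = v ! (length v - q + k)" for i h v
    using that unfolding Jb_def by blast
  have cb: "card Jb \<le> 2 * n"
  proof -
    have "\<forall>i\<in>Jb. \<exists>h v. h \<in> C i \<and> v \<in> W \<and> E < h + 2 * q \<and> h \<le> E \<and> q \<le> length v \<and>
      (\<forall>k<q. w ! (h - q + k) = v ! (length v - q + k))" by (auto simp: Jb_def)
    then obtain h v where hv: "\<And>i. i \<in> Jb \<Longrightarrow> h i \<in> C i \<and> v i \<in> W \<and> E < h i + 2 * q \<and>
      h i \<le> E \<and> q \<le> length (v i) \<and> (\<forall>k<q. w ! (h i - q + k) = v i ! (length (v i) - q + k))"
      by metis
    \<comment> \<open>The word fixes the phase of the cut, and the second component tells in which of the last
      two periods the cut lies; so equal values mean a common cut.\<close>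
    have "inj_on (\<lambda>i. (v i, E < h i + q)) Jb"
    proof (rule inj_onI, rule ccontr)
      fix i j assume ij: "i \<in> Jb" "j \<in> Jb" "(v i, E < h i + q) = (v j, E < h j + q)" "i \<noteq> j"
      have i: "i \<in> I" "i \<in> J" and j: "j \<in> I" "j \<in> J" using ij J3 by (auto simp: Jb_def)
      have A: "A + 2 * q \<le> h i" "A + 2 * q \<le> h j"
        using C_bounds[OF i(1)] C_bounds[OF j(1)] hv[OF ij(1)] hv[OF ij(2)] sJ[OF i(2)] sJ[OF j(2)]
        by (meson le_trans)+
      have ph: "h i mod q = h j mod q"
        by (rule phase) (use A hv[OF ij(1)] hv[OF ij(2)] ij(3) in auto)
      have near: "h i < h j + q" "h j < h i + q" using hv[OF ij(1)] hv[OF ij(2)] ij(3) by auto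
      have "h i = h j"
      proof (cases "h i \<le> h j")
        case True
        hence "q dvd h j - h i" using ph by (metis mod_eq_dvd_iff_nat)
        thus ?thesis using near True by (auto dest: dvd_imp_le)
      next
        case False
        hence "q dvd h i - h j" using ph by (metis mod_eq_dvd_iff_nat nat_le_linear)
        thus ?thesis using near False by (auto dest: dvd_imp_le)
      qed
      thus False using C_disjoint[OF i(1) j(1) ij(4)] hv[OF ij(1)] hv[OF ij(2)] by auto
    qed
    hence "card Jb \<le> card (W \<times> (UNIV :: bool set))"
      by (rule card_inj_on_le) (use hv fin in auto)
    thus ?thesis by (simp add: card_cartesian_product)
  qed

  \<comment> \<open>All other parses: near the end of the run they only use words that reach back by less than
    \<open>q\<close>.\<close>
  define Jc where "Jc = J3 - Ja - Jb"
  have cc: "card Jc \<le> n"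
  proof (rule ccontr)
    assume "\<not> card Jc \<le> n"
    hence big: "n < card Jc" by simp
    have "\<exists>q'. 0 < q' \<and> q' < q \<and> periodic_on ((!) w) (E - 2 * q) E q'"
    proof (rule periodic_of_disjoint_covers[OF fin big, where D = C])
      show "E - 2 * q + 1 < E" using q(1) AE by linarith
    next
      fix i j assume "i \<in> Jc" "j \<in> Jc" "i \<noteq> j"
      thus "C i \<inter> C j = {}" using C_disjoint J3 by (auto simp: Jc_def)
    next
      fix i p assume i: "i \<in> Jc" and p: "E - 2 * q < p" "p < E"
      have i3: "i \<in> J3" "i \<notin> Ja" "i \<notin> Jb" using i by (auto simp: Jc_def)
      note iI = J3[OF i3(1)]
      have "s i \<le> E - 2 * q"
      proof (rule ccontr)
        assume h: "\<not> s i \<le> E - 2 * q"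
        have qY: "q \<le> length Y" using s_less[OF iI(1)] sJ[OF iI(2)] by linarith
        have "w ! (s i - q + k) = Y ! (length Y - q + k)" if k: "k < q" for k
        proof -
          have "w ! (s i - q + k) = rev Y ! (s i - 1 - (s i - q + k))"
            by (rule border[OF iI(1)]) (use sJ[OF iI(2)] k in auto)
          also have "s i - 1 - (s i - q + k) = q - 1 - k" using sJ[OF iI(2)] k by auto
          also have "rev Y ! \<dots> = Y ! (length Y - q + k)" using k qY by (simp add: rev_nth)
          finally show ?thesis .
        qed
        moreover have "E < s i + 2 * q" using h by linarith
        ultimately have "i \<in> Jb"
          by (intro JbI[OF i3(1) C_start[OF iI(1)] YW]) (use sJ[OF iI(2)] qY in auto)
        thus False using i3 by simp
      qed
      hence "s i \<le> p" "p < d i" using p iI by auto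
      then obtain \<gamma> v where \<gamma>v: "\<gamma> \<in> C i" "v \<in> W" "\<gamma> \<le> p" "p < \<gamma> + length v"
        "\<forall>y<length v. \<gamma> + y < d i \<longrightarrow> w ! (\<gamma> + y) = v ! y"
        "\<gamma> + length v \<le> d i \<longrightarrow> \<gamma> + length v \<in> C i"
        using C_cover[OF iI(1)] by blast
      have "p - \<gamma> < q"
      proof (cases "E < \<gamma> + length v")
        case True
        hence "\<not> \<gamma> + q \<le> E" using i3 \<gamma>v by (auto simp: Ja_def)
        thus ?thesis using p by linarith
      next
        case False
        have "\<not> q \<le> length v"
        proof
          assume qv: "q \<le> length v"
          have hC: "\<gamma> + length v \<in> C i" using False \<gamma>v(6) iI by auto
          have "w ! (\<gamma> + length v - q + k) = v ! (length v - q + k)" if k: "k < q" for k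
          proof -
            have "\<gamma> + length v - q + k = \<gamma> + (length v - q + k)" "length v - q + k < length v"
              "\<gamma> + (length v - q + k) < d i"
              using k qv False iI by auto
            thus ?thesis using \<gamma>v(5) by metis
          qed
          moreover have "E < \<gamma> + length v + 2 * q" using \<gamma>v(4) p by linarith
          ultimately have "i \<in> Jb" by (intro JbI[OF i3(1) hC \<gamma>v(2)]) (use qv False in auto)
          thus False using i3 by simp
        qed
        thus ?thesis using \<gamma>v by linarith
      qed
      thus "\<exists>\<gamma>\<in>C i. \<exists>v\<in>W. \<gamma> \<le> p \<and> p < \<gamma> + length v \<and> p - \<gamma> < q \<and>
        (\<forall>y<length v. \<gamma> + y < E \<longrightarrow> w ! (\<gamma> + y) = v ! y)"
        using \<gamma>v iI(3) by (meson less_trans)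
    qed
    then obtain q' where q': "0 < q'" "q' < q" "periodic_on ((!) w) (E - 2 * q) E q'" by blast
    have "periodic_on ((!) w) A E q'"
      by (rule period_of_window[OF E(2) q(1) _ _ q'(3,2)]) (use AE in auto)
    thus False using least q' by blast
  qed

  have "J = J1 \<union> J2 \<union> J3" by (auto simp: J1_def J2_def J3_def)
  moreover have "J3 = Ja \<union> Jb \<union> Jc" by (auto simp: Jc_def Ja_def Jb_def)
  ultimately have "J = J1 \<union> J2 \<union> (Ja \<union> Jb \<union> Jc)" by simp
  hence "card J = card (J1 \<union> J2 \<union> (Ja \<union> Jb \<union> Jc))" by (rule arg_cong)
  hence "card J \<le> card J1 + card J2 + (card Ja + card Jb + card Jc)"
    using card_Un_le[of "J1 \<union> J2" "Ja \<union> Jb \<union> Jc"] card_Un_le[of J1 J2]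
      card_Un_le[of "Ja \<union> Jb" Jc] card_Un_le[of Ja Jb] by linarith
  thus ?thesis using c1 c2 ca cb cc by linarith
qed simp

end

section \<open>A geometric scale of overlaps\<close>

text \<open>
  A subsequence \<open>t 0 < t 1 < \<dots> < t U\<close> of the overlap lengths with at least \<open>4 * n + 2\<close> overlaps
  in each step, so that, by \<open>overlaps_ending_in_run\<close>, no periodic run covers a whole step with
  two periods to spare on its left.
\<close>
locale scaled_overlap_family = overlap_family +
  fixes t :: "nat \<Rightarrow> nat" and U :: nat
  assumes t_in: "k \<le> U \<Longrightarrow> t k \<in> s ` I"
    and t_unit: "k < U \<Longrightarrow> 4 * n + 2 \<le> card {i \<in> I. t k \<le> s i \<and> s i < t (Suc k)}"
begin

lemma t_strict: "k < U \<Longrightarrow> t k < t (Suc k)"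
proof (rule ccontr)
  assume "k < U" "\<not> t k < t (Suc k)"
  hence "{i \<in> I. t k \<le> s i \<and> s i < t (Suc k)} = {}" by auto
  thus False using t_unit[OF \<open>k < U\<close>] by (metis card.empty add_is_0 le_zero_eq zero_neq_numeral)
qed

lemma t_less: "k < l \<Longrightarrow> l \<le> U \<Longrightarrow> t k < t l"
proof (induction l)
  case (Suc l)
  thus ?case using t_strict[of l] by (cases "k = l") auto
qed simp

lemma t_mono: "k \<le> l \<Longrightarrow> l \<le> U \<Longrightarrow> t k \<le> t l"
  using t_less[of k l] by (cases "k = l") auto

lemma t_less_lengths: "k \<le> U \<Longrightarrow> t k < length w \<and> t k < length Y"
  using t_in[of k] s_less d_less s_le_d by (force intro: le_less_trans)

lemma no_run_over_unit:
  assumes "k < U" and per: "periodic_on ((!) w) A E0 q0" "0 < q0" "E0 \<le> length w"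
    and k: "A + 2 * q0 \<le> t k" "t (Suc k) \<le> E0"
  shows False
proof -
  define J where "J = {i \<in> I. t k \<le> s i \<and> s i < t (Suc k)}"
  obtain i where i: "i \<in> I" "s i = t (Suc k)" using t_in[of "Suc k"] assms(1) by auto
  have "finite J" using finI by (simp add: J_def)
  hence "card (insert i J) = Suc (card J)" using i by (simp add: J_def)
  moreover have "card (insert i J) \<le> 4 * n + 2"
    by (rule overlaps_ending_in_run[OF per(1,2,3)]) (use i k t_strict[OF assms(1)] in \<open>auto simp: J_def\<close>)
  ultimately show False using t_unit[OF assms(1)] by (simp add: J_def)
qed

text \<open>
  Two overlaps of lengths \<open>t k\<close> and \<open>t (k + 1)\<close> make a run with period \<open>t (k + 1) - t k\<close> out of
  the prefix of \<open>w\<close>; unless this period is at least half of \<open>t k\<close>, the run covers the step with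
  two periods to spare.
\<close>
lemma t_growth:
  assumes "k < U"
  shows "3 * t k \<le> 2 * t (Suc k)"
proof (rule ccontr)
  assume h: "\<not> 3 * t k \<le> 2 * t (Suc k)"
  obtain i j where ij: "i \<in> I" "j \<in> I" "s i = t k" "s j = t (Suc k)"
    using t_in[of k] t_in[of "Suc k"] assms by force
  show False
    by (rule no_run_over_unit[OF assms border_period[OF ij(1,2)]])
      (use ij t_strict[OF assms] h s_le_d[of j] d_less[of j] in auto)
qed

lemma t_double: "Suc (Suc k) \<le> l \<Longrightarrow> l \<le> U \<Longrightarrow> 2 * t k \<le> t l"
  using t_growth[of k] t_growth[of "Suc k"] t_mono[of "Suc (Suc k)" l] by linarith

lemma t_triple: "Suc (Suc (Suc k)) \<le> l \<Longrightarrow> l \<le> U \<Longrightarrow> 3 * t k \<le> t l"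
  using t_growth[of k] t_growth[of "Suc k"] t_growth[of "Suc (Suc k)"]
    t_mono[of "Suc (Suc (Suc k))" l] by linarith

text \<open>
  Otherwise each of \<open>n\<close> disjoint blocks of \<open>B\<close> steps would contain the length of a word, and a
  different one for each block; but \<open>w\<close> itself is longer than the whole scale, which leaves only
  \<open>n - 1\<close> words.
\<close>
lemma scale_gap_exists:
  assumes U: "U = n * B"
  shows "\<exists>a. a + B \<le> U \<and> (\<forall>v\<in>W. \<not> (t a < length v \<and> length v \<le> t (a + B)))"
proof (rule ccontr)
  assume neg: "\<not> ?thesis"
  have bnd: "k * B + B \<le> U" if "k < n" for k
  proof -
    have "Suc k * B \<le> n * B" by (rule mult_le_mono1[OF Suc_leI[OF that]])
    moreover have "Suc k * B = k * B + B" by (simp only: mult_Suc add.commute)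
    ultimately show ?thesis unfolding U by linarith
  qed
  have "\<forall>k<n. \<exists>v\<in>W. t (k * B) < length v \<and> length v \<le> t (k * B + B)"
    using neg bnd by blast
  then obtain v where v: "\<And>k. k < n \<Longrightarrow> v k \<in> W \<and> t (k * B) < length (v k) \<and> length (v k) \<le> t (k * B + B)"
    by metis
  have "inj_on v {..<n}"
  proof (rule linorder_inj_onI)
    fix k l assume kl: "k < l" "k \<in> {..<n}" "l \<in> {..<n}"
    have "Suc k * B \<le> l * B" by (rule mult_le_mono1[OF Suc_leI[OF kl(1)]])
    hence "k * B + B \<le> l * B" by (simp only: mult_Suc add.commute)
    hence "t (k * B + B) \<le> t (l * B)" using bnd[of l] kl by (intro t_mono) auto
    thus "v k \<noteq> v l" using v[of k] v[of l] kl by force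
  qed auto
  moreover have "v ` {..<n} \<subseteq> W - {w}"
  proof (intro subsetI)
    fix x assume "x \<in> v ` {..<n}"
    then obtain k where k: "k < n" "x = v k" by auto
    have "length (v k) < length w"
      using v[OF k(1)] t_less_lengths[of "k * B + B"] bnd[OF k(1)] by linarith
    thus "x \<in> W - {w}" using v[OF k(1)] k by auto
  qed
  ultimately have "card {..<n} \<le> card (W - {w})" using fin by (intro card_inj_on_le) auto
  moreover have "card (W - {w}) < n" by (rule card_Diff1_less[OF fin wW])
  ultimately show False by simp
qed

text \<open>
  The second parses with these indices all read the text of \<open>w\<close> from \<open>t e\<close> to \<open>t (e + 7)\<close>, and
  each word is either short (at most \<open>t a\<close>) or long (more than \<open>t b\<close>). If two of them place the
  same long word at different positions up to \<open>t (e + 4)\<close>, their distance is a period from there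
  to \<open>t (e + 7)\<close>; as the cuts are disjoint, each long word thus serves one parse at most. The
  parses without long words in this range cover the text from \<open>t e\<close> to \<open>t (e + 4)\<close> by short
  words, and more than \<open>n\<close> of them force a period below \<open>t a\<close>. In both cases the run covers a
  whole step of the scale.
\<close>
lemma few_late_mismatches:
  assumes e: "a \<le> e" "e + 7 \<le> b" "b \<le> U"
    and gap: "\<And>v. v \<in> W \<Longrightarrow> length v \<le> t a \<or> t b < length v"
  shows "card {i \<in> I. s i \<le> t e \<and> t (e + 7) \<le> d i} \<le> 2 * n"
proof -
  define G where "G = {i \<in> I. s i \<le> t e \<and> t (e + 7) \<le> d i}"
  define long where "long i \<longleftrightarrow> (\<exists>\<mu>\<in>C i. \<exists>v\<in>W. \<mu> \<le> t (e + 4) \<and> t b < length v \<and>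
    (\<forall>y<length v. \<mu> + y < d i \<longrightarrow> w ! (\<mu> + y) = v ! y))" for i
  define GL where "GL = {i \<in> G. long i}"
  define GS where "GS = {i \<in> G. \<not> long i}"
  have finG: "finite G" using finI by (simp add: G_def)
  have GI: "i \<in> I" "s i \<le> t e" "t (e + 7) \<le> d i" if "i \<in> G" for i using that by (auto simp: G_def)
  have tb: "t (e + 7) \<le> t b" by (rule t_mono) (use e in auto)
  have cl: "card GL \<le> n"
  proof -
    have "\<forall>i\<in>GL. \<exists>\<mu> v. \<mu> \<in> C i \<and> v \<in> W \<and> \<mu> \<le> t (e + 4) \<and> t b < length v \<and>
      (\<forall>y<length v. \<mu> + y < d i \<longrightarrow> w ! (\<mu> + y) = v ! y)" by (auto simp: GL_def long_def)
    then obtain \<mu> v where lv: "\<And>i. i \<in> GL \<Longrightarrow> \<mu> i \<in> C i \<and> v i \<in> W \<and> \<mu> i \<le> t (e + 4) \<and>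
      t b < length (v i) \<and> (\<forall>y<length (v i). \<mu> i + y < d i \<longrightarrow> w ! (\<mu> i + y) = v i ! y)"
      by metis
    have main: False if h: "i \<in> GL" "j \<in> GL" "v i = v j" "\<mu> i < \<mu> j" for i j
    proof -
      have G: "i \<in> G" "j \<in> G" using h by (auto simp: GL_def)
      define g where "g = \<mu> j - \<mu> i"
      have per: "periodic_on ((!) w) (\<mu> i) (t (e + 7)) g"
        unfolding periodic_on_def
      proof (intro allI impI)
        fix y assume y: "\<mu> i \<le> y \<and> y + g < t (e + 7)"
        define k where "k = y - \<mu> i"
        have k: "y = \<mu> i + k" "y + g = \<mu> j + k" using y h(4) unfolding k_def g_def by linarith+
        have kv: "k < length (v i)" "\<mu> i + k < d i" "\<mu> j + k < d j"
          using y k lv[OF h(1)] tb GI(3)[OF G(1)] GI(3)[OF G(2)] by linarith+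
        have "w ! y = v i ! k" using lv[OF h(1)] kv(1,2) unfolding k(1) by blast
        moreover have "w ! (y + g) = v i ! k" using lv[OF h(2)] kv(1,3) h(3) unfolding k(2) by metis
        ultimately show "w ! y = w ! (y + g)" by simp
      qed
      have "2 * t (e + 4) \<le> t (e + 6)" by (rule t_double) (use e in auto)
      hence "\<mu> i + 2 * g \<le> t (e + 6)" using lv[OF h(2)] h(4) unfolding g_def by linarith
      moreover have "t (e + 7) \<le> length w" using t_less_lengths[of "e + 7"] e by simp
      ultimately show False
        using no_run_over_unit[OF _ per, of "e + 6"] h(4) e by (simp add: g_def eval_nat_numeral)
    qed
    have "inj_on v GL"
    proof (rule inj_onI, rule ccontr)
      fix i j assume h: "i \<in> GL" "j \<in> GL" "v i = v j" "i \<noteq> j"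
      have "\<mu> i \<noteq> \<mu> j" using C_disjoint[of i j] h lv[OF h(1)] lv[OF h(2)] GI by (auto simp: GL_def)
      thus False using main[of i j] main[of j i] h by (metis linorder_neqE_nat)
    qed
    thus ?thesis by (rule card_inj_on_le) (use lv fin in auto)
  qed
  have cs: "card GS \<le> n"
  proof (rule ccontr)
    assume "\<not> ?thesis"
    hence big: "n < card GS" by simp
    have t4: "t (e + 4) \<le> t (e + 7)" by (rule t_mono) (use e in auto)
    have "\<exists>q. 0 < q \<and> q < t a \<and> periodic_on ((!) w) (t e) (t (e + 4)) q"
    proof (rule periodic_of_disjoint_covers[OF fin big, where D = C])
      show "t e + 1 < t (e + 4)" using t_less[of e "e + 1"] t_less[of "e + 1" "e + 4"] e by linarith
    next
      fix i j assume "i \<in> GS" "j \<in> GS" "i \<noteq> j"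
      thus "C i \<inter> C j = {}" using C_disjoint GI by (auto simp: GS_def)
    next
      fix i p assume i: "i \<in> GS" and p: "t e < p" "p < t (e + 4)"
      have iG: "i \<in> G" "\<not> long i" using i by (auto simp: GS_def)
      obtain \<gamma> v where \<gamma>v: "\<gamma> \<in> C i" "v \<in> W" "\<gamma> \<le> p" "p < \<gamma> + length v"
        "\<forall>y<length v. \<gamma> + y < d i \<longrightarrow> w ! (\<gamma> + y) = v ! y"
        using C_cover[of i p] GI[OF iG(1)] p t4 by (meson le_less_trans less_imp_le less_le_trans)
      have "\<not> t b < length v" using \<gamma>v p iG(2) unfolding long_def by (meson le_trans less_imp_le)
      hence "length v \<le> t a" using gap \<gamma>v(2) by blast
      hence "p - \<gamma> < t a" using \<gamma>v(3,4) by linarith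
      moreover have "\<forall>y<length v. \<gamma> + y < t (e + 4) \<longrightarrow> w ! (\<gamma> + y) = v ! y"
        using \<gamma>v(5) GI(3)[OF iG(1)] t4 by auto
      ultimately show "\<exists>\<gamma>\<in>C i. \<exists>v\<in>W. \<gamma> \<le> p \<and> p < \<gamma> + length v \<and> p - \<gamma> < t a \<and>
        (\<forall>y<length v. \<gamma> + y < t (e + 4) \<longrightarrow> w ! (\<gamma> + y) = v ! y)"
        using \<gamma>v(1-4) by blast
    qed
    then obtain q where q: "0 < q" "q < t a" "periodic_on ((!) w) (t e) (t (e + 4)) q" by blast
    have "t a \<le> t e" by (rule t_mono) (use e in auto)
    moreover have "3 * t e \<le> t (e + 3)" by (rule t_triple) (use e in auto)
    moreover have "t (e + 4) \<le> length w" using t_less_lengths[of "e + 4"] e by simp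
    ultimately show False
      using no_run_over_unit[OF _ q(3), of "e + 3"] q e by (simp add: eval_nat_numeral)
  qed
  have "card G = card GL + card GS"
    using finG by (subst card_Un_disjoint[symmetric]) (auto simp: GL_def GS_def intro: arg_cong[where f = card])
  thus ?thesis using cl cs unfolding G_def by linarith
qed

text \<open>
  Choose overlaps \<open>\<iota> 0, \<dots>, \<iota> (n + 1)\<close>, eight steps of the scale apart, such that the mismatch
  position of each lies before the end of the next overlap. For \<open>j = 1, \<dots>, n + 1\<close> look at how
  the first parse of \<open>\<iota> (j - 1)\<close> reads the last \<open>s (\<iota> j)\<close> letters of \<open>Y\<close>. These letters are also
  the first \<open>s (\<iota> j)\<close> letters of \<open>w\<close>, so that the cuts can be carried over to \<open>w\<close>. There they
  are disjoint for different \<open>j\<close>, by \<open>no_transport\<close>.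

  If long words occur for two values of \<open>j\<close>, they are different, since the same long word at two
  distances from the end of \<open>Y\<close> would make a long run in \<open>w\<close>. If only short words occur, the
  carried parse covers a common window near \<open>t a\<close> by short words, and this can happen for at
  most as many values of \<open>j\<close> as there are short words. So \<open>n + 1\<close> would be at most the number of
  words.

  The last four of the \<open>8 * n + 12\<close> steps leave room for a run behind the overlap of length
  \<open>t (a + 8 * n + 8)\<close>.
\<close>
lemma no_scale_gap:
  assumes b: "b = a + 8 * n + 12" "b \<le> U"
    and gap: "\<And>v. v \<in> W \<Longrightarrow> length v \<le> t a \<or> t b < length v"
  shows False
proof -
  have n0: "0 < n" using wW fin by (auto simp: card_gt_0_iff)
  have ex: "\<exists>i\<in>I. t (a + 8 * k) \<le> s i \<and> (k \<le> n \<longrightarrow> s i < t (a + 8 * k + 1) \<and> d i < t (a + 8 * k + 8)) \<and>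
    s i \<le> t (a + 8 * n + 8)"
    if k: "k \<le> n + 1" for k
  proof (cases "k = n + 1")
    case True
    have k8: "a + 8 * k = a + 8 * n + 8" using True by simp
    obtain i where "i \<in> I" "s i = t (a + 8 * n + 8)" using t_in[of "a + 8 * n + 8"] b by auto
    thus ?thesis unfolding k8 using True by (intro bexI[of _ i]) auto
  next
    case False
    hence kn: "k \<le> n" using k by simp
    define J where "J = {i \<in> I. t (a + 8 * k) \<le> s i \<and> s i < t (Suc (a + 8 * k))}"
    define G where "G = {i \<in> I. s i \<le> t (a + 8 * k + 1) \<and> t (a + 8 * k + 8) \<le> d i}"
    \<comment> \<open>At most \<open>2 * n\<close> of the overlaps in this step have their mismatch beyond the next seven
      steps, and \<open>\<iota> k\<close> is one of the others.\<close>
    have k17: "a + 8 * k + 1 + 7 = a + 8 * k + 8" by simp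
    have "card {i \<in> I. s i \<le> t (a + 8 * k + 1) \<and> t (a + 8 * k + 1 + 7) \<le> d i} \<le> 2 * n"
      by (rule few_late_mismatches[OF _ _ b(2) gap]) (use b kn in auto)
    hence "card G \<le> 2 * n" unfolding G_def k17 .
    moreover have "4 * n + 2 \<le> card J" unfolding J_def by (rule t_unit) (use b kn in auto)
    moreover have "card J \<le> card G" if "J \<subseteq> G" by (rule card_mono) (use that finI in \<open>auto simp: G_def\<close>)
    ultimately have "\<not> J \<subseteq> G" by linarith
    then obtain i where i: "i \<in> J" "i \<notin> G" by blast
    have "t (a + 8 * k + 1) \<le> t (a + 8 * n + 8)" by (rule t_mono) (use b kn in auto)
    thus ?thesis using i kn unfolding J_def G_def
      by (intro bexI[of _ i]) auto
  qed
  hence "\<forall>k. \<exists>i. k \<le> n + 1 \<longrightarrow> i \<in> I \<and> t (a + 8 * k) \<le> s i \<and>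
      (k \<le> n \<longrightarrow> s i < t (a + 8 * k + 1) \<and> d i < t (a + 8 * k + 8)) \<and> s i \<le> t (a + 8 * n + 8)"
    by blast
  from choice[OF this] obtain \<iota> where \<iota>: "\<And>k. k \<le> n + 1 \<Longrightarrow> \<iota> k \<in> I \<and> t (a + 8 * k) \<le> s (\<iota> k) \<and>
      (k \<le> n \<longrightarrow> s (\<iota> k) < t (a + 8 * k + 1) \<and> d (\<iota> k) < t (a + 8 * k + 8)) \<and>
      s (\<iota> k) \<le> t (a + 8 * n + 8)"
    by blast
  have \<iota>_step: "s (\<iota> k) < s (\<iota> l)" "d (\<iota> k) < s (\<iota> l)" if "k < l" "l \<le> n + 1" for k l
  proof -
    have "t (a + 8 * k + 8) \<le> t (a + 8 * l)" by (rule t_mono) (use b that in auto)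
    thus "d (\<iota> k) < s (\<iota> l)" using \<iota>[of k] \<iota>[of l] that by force
    thus "s (\<iota> k) < s (\<iota> l)" using s_le_d[of "\<iota> k"] \<iota>[of k] that by force
  qed
  define T where "T = t b"
  define Wl where "Wl = {v \<in> W. T < length v}"
  define Ws where "Ws = {v \<in> W. length v \<le> t a}"
  have ab: "t a \<le> t b" by (rule t_mono) (use b in auto)
  have cW: "card Wl + card Ws \<le> n"
  proof -
    have "card Wl + card Ws = card (Wl \<union> Ws)"
      using fin ab by (intro card_Un_disjoint[symmetric]) (auto simp: Wl_def Ws_def T_def)
    also have "\<dots> \<le> n" by (rule card_mono[OF fin]) (auto simp: Wl_def Ws_def)
    finally show ?thesis .
  qed
  \<comment> \<open>The first parse of \<open>\<iota> (j - 1)\<close> has a long word whose right end is among the last \<open>s (\<iota> j)\<close>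
    letters of \<open>Y\<close>.\<close>
  define bad where "bad j \<longleftrightarrow> (\<exists>\<epsilon>\<in>K (\<iota> (j - 1)). \<exists>v\<in>Wl. \<epsilon> < s (\<iota> j) \<and>
    (\<forall>y<length v. \<epsilon> + y < length Y \<longrightarrow> rev Y ! (\<epsilon> + y) = rev v ! y))" for j
  define N where "N = {1..n + 1}"
  define NB where "NB = {j \<in> N. bad j}"
  define NG where "NG = {j \<in> N. \<not> bad j}"
  have cb: "card NB \<le> card Wl"
  proof -
    have "\<forall>j\<in>NB. \<exists>\<epsilon> v. \<epsilon> \<in> K (\<iota> (j - 1)) \<and> v \<in> Wl \<and> \<epsilon> < s (\<iota> j) \<and>
      (\<forall>y<length v. \<epsilon> + y < length Y \<longrightarrow> rev Y ! (\<epsilon> + y) = rev v ! y)" by (auto simp: NB_def bad_def)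
    then obtain \<epsilon> v where ev: "\<And>j. j \<in> NB \<Longrightarrow> \<epsilon> j \<in> K (\<iota> (j - 1)) \<and> v j \<in> Wl \<and>
      \<epsilon> j < s (\<iota> j) \<and> (\<forall>y<length (v j). \<epsilon> j + y < length Y \<longrightarrow> rev Y ! (\<epsilon> j + y) = rev (v j) ! y)"
      by metis
    have "inj_on v NB"
    proof (rule linorder_inj_onI)
      fix j j' assume jj: "j < j'" "j \<in> NB" "j' \<in> NB"
      show "v j \<noteq> v j'"
      proof
        assume eq: "v j = v j'"
        have N: "1 \<le> j" "j' \<le> n + 1" using jj by (auto simp: NB_def N_def)
        have "j < j' - 1 \<or> j = j' - 1" using jj(1) by linarith
        hence "s (\<iota> j) \<le> s (\<iota> (j' - 1))"
          using \<iota>_step(1)[of j "j' - 1"] N by (auto intro: less_imp_le)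
        also have "\<dots> \<le> \<epsilon> j'" using K_bounds[of "\<iota> (j' - 1)"] \<iota>[of "j' - 1"] ev[OF jj(3)] N by auto
        finally have lt: "\<epsilon> j < \<epsilon> j'" using ev[OF jj(2)] by simp
        \<comment> \<open>The distance between the two copies of the long word is a period, carried over to \<open>w\<close>
          by the overlap of length \<open>T\<close>.\<close>
        define g where "g = \<epsilon> j' - \<epsilon> j"
        obtain i where i: "i \<in> I" "s i = T" using t_in[of b] b(2) unfolding T_def by auto
        have TY: "T < length Y" using t_less_lengths[of b] b(2) by (simp add: T_def)
        have per: "periodic_on ((!) w) 0 (T - \<epsilon> j) g"
          unfolding periodic_on_def
        proof (intro allI impI)
          fix y assume y: "0 \<le> y \<and> y + g < T - \<epsilon> j"
          define k where "k = T - 1 - (y + g) - \<epsilon> j"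
          have k: "T - 1 - (y + g) = \<epsilon> j + k" "T - 1 - y = \<epsilon> j' + k" "k < T"
            "\<epsilon> j + k < T" "\<epsilon> j' + k < T"
            using y lt unfolding k_def g_def by linarith+
          have kv: "k < length (v j)" using ev[OF jj(2)] k(3) by (auto simp: Wl_def)
          have "w ! y = rev Y ! (T - 1 - y)" using border[OF i(1), of y] i(2) y by auto
          also have "\<dots> = rev (v j) ! k"
            unfolding k(2) using ev[OF jj(3)] kv eq k(5) TY by (metis less_trans)
          also have "\<dots> = rev Y ! (T - 1 - (y + g))"
            unfolding k(1) using ev[OF jj(2)] kv k(4) TY by (metis less_trans)
          also have "\<dots> = w ! (y + g)" using border[OF i(1), of "y + g"] i(2) y by auto
          finally show "w ! y = w ! (y + g)" .
        qed
        have e1: "2 * t (a + 8 * n + 8) \<le> t (a + 8 * n + 10)" by (rule t_double) (use b in auto)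
        have e2: "3 * t (a + 8 * n + 11) \<le> 2 * t (Suc (a + 8 * n + 11))" by (rule t_growth) (use b in auto)
        have e3: "t (a + 8 * n + 10) \<le> t (a + 8 * n + 11)" by (rule t_mono) (use b in auto)
        have Tb: "t (Suc (a + 8 * n + 11)) = T"
        proof -
          have "Suc (a + 8 * n + 11) = b" unfolding b(1) by simp
          thus ?thesis unfolding T_def by (rule arg_cong)
        qed
        have "\<epsilon> j' \<le> t (a + 8 * n + 8)" "\<epsilon> j \<le> t (a + 8 * n + 8)"
          using ev[OF jj(3)] ev[OF jj(2)] \<iota>[of j'] \<iota>[of j] N jj(1) by force+
        hence k1: "0 + 2 * g \<le> t (a + 8 * n + 10)" "t (Suc (a + 8 * n + 10)) \<le> T - \<epsilon> j"
        proof -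
          have "Suc (a + 8 * n + 10) = a + 8 * n + 11" by simp
          moreover have "t (a + 8 * n + 11) \<le> T - \<epsilon> j"
            using e1 e2 e3 Tb \<open>\<epsilon> j \<le> t (a + 8 * n + 8)\<close> by linarith
          ultimately show "t (Suc (a + 8 * n + 10)) \<le> T - \<epsilon> j" by (simp only:)
          show "0 + 2 * g \<le> t (a + 8 * n + 10)"
            using e1 \<open>\<epsilon> j' \<le> t (a + 8 * n + 8)\<close> unfolding g_def by linarith
        qed
        show False
          by (rule no_run_over_unit[OF _ per _ _ k1])
            (use b lt t_less_lengths[of b] in \<open>auto simp: g_def T_def\<close>)
      qed
    qed auto
    thus ?thesis by (rule card_inj_on_le) (use ev fin in \<open>auto simp: Wl_def\<close>)
  qed
  have cg: "card NG \<le> card Ws"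
  proof (rule ccontr)
    assume "\<not> ?thesis"
    hence big: "card Ws < card NG" by simp
    have finWs: "finite Ws" using fin by (simp add: Ws_def)
    \<comment> \<open>The cuts inside \<open>Y\<close>, read as positions in \<open>w\<close> when the last \<open>s (\<iota> j)\<close> letters of \<open>Y\<close> are
      put on the start of \<open>w\<close>.\<close>
    define D where "D j = {\<gamma>. 0 < \<gamma> \<and> \<gamma> \<le> s (\<iota> j) \<and> s (\<iota> j) - \<gamma> \<in> K (\<iota> (j - 1))}" for j
    define E where "E = t (a + 4)"
    have "\<exists>q. 0 < q \<and> q < t a \<and> periodic_on ((!) w) (t a) E q"
    proof (rule periodic_of_disjoint_covers[OF finWs big, where D = D])
      show "t a + 1 < E" unfolding E_def using t_less[of a "a + 1"] t_less[of "a + 1" "a + 4"] b by linarith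
    next
      fix i j assume ij: "i \<in> NG" "j \<in> NG" "i \<noteq> j"
      have main: "D j \<inter> D j' = {}" if h: "j \<in> N" "j' \<in> N" "j < j'" for j j'
      proof (rule ccontr)
        assume "D j \<inter> D j' \<noteq> {}"
        then obtain \<gamma> where \<gamma>: "\<gamma> \<in> D j" "\<gamma> \<in> D j'" by blast
        have I: "\<iota> j \<in> I" "\<iota> j' \<in> I" "\<iota> (j' - 1) \<in> I" "\<iota> (j - 1) \<in> I"
          using h \<iota>[of j] \<iota>[of j'] \<iota>[of "j' - 1"] \<iota>[of "j - 1"] by (auto simp: N_def)
        show False
          by (rule no_transport[OF I, of \<gamma>]) (use \<gamma> \<iota>_step(2)[of j j'] h in \<open>auto simp: D_def N_def\<close>)
      qed
      show "D i \<inter> D j = {}" using main[of i j] main[of j i] ij by (cases "i < j") (auto simp: NG_def)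
    next
      fix j p assume j: "j \<in> NG" and p: "t a < p" "p < E"
      have jN: "1 \<le> j" "j \<le> n + 1" "\<not> bad j" using j by (auto simp: NG_def N_def)
      define \<sigma> where "\<sigma> = s (\<iota> j)"
      \<comment> \<open>At least two steps, and hence a factor of two, separate \<open>s (\<iota> j)\<close> both from the window
        and from \<open>s (\<iota> (j - 1))\<close>; so their sum is at most \<open>s (\<iota> j)\<close>, and the window corresponds
        to a part of \<open>Y\<close> to the left of the start of \<open>w\<close> in the branching \<open>\<iota> (j - 1)\<close>.\<close>
      define m where "m = a + 8 * j - 2"
      have m: "m + 2 = a + 8 * j" "a + 4 \<le> m" "a + 8 * (j - 1) + 1 \<le> m" "m \<le> U"
        using jN b unfolding m_def by linarith+
      have iI: "\<iota> j \<in> I" "\<iota> (j - 1) \<in> I" using \<iota>[of j] \<iota>[of "j - 1"] jN by auto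
      have "2 * t m \<le> t (a + 8 * j)" by (rule t_double) (use m b jN in auto)
      moreover have "t (a + 4) \<le> t m" "t (a + 8 * (j - 1) + 1) \<le> t m" by (rule t_mono; use m in auto)+
      moreover have "s (\<iota> (j - 1)) < t (a + 8 * (j - 1) + 1)" using \<iota>[of "j - 1"] jN by force
      moreover have "t (a + 8 * j) \<le> \<sigma>" using \<iota>[of j] jN unfolding \<sigma>_def by blast
      ultimately have X: "s (\<iota> (j - 1)) \<le> \<sigma> - 1 - p" "p < \<sigma>" using p unfolding E_def by linarith+
      have \<sigma>Y: "\<sigma> < length Y" using s_less[OF iI(1)] by (simp add: \<sigma>_def)
      obtain x v where xv: "x \<in> K (\<iota> (j - 1))" "v \<in> W" "x \<le> \<sigma> - 1 - p" "\<sigma> - 1 - p < x + length v"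
        "\<forall>y<length v. x + y < length Y \<longrightarrow> rev Y ! (x + y) = rev v ! y"
        "x + length v \<le> length Y \<longrightarrow> x + length v \<in> K (\<iota> (j - 1))"
        using K_cover[OF iI(2) X(1)] \<sigma>Y by (metis less_imp_diff_less)
      have "x < \<sigma>" using xv(3) X(2) by linarith
      hence "v \<notin> Wl" using jN(3) xv(1,5) unfolding bad_def \<sigma>_def by blast
      hence v: "v \<in> Ws" "length v \<le> t a" using gap[OF xv(2)] xv(2) by (auto simp: Wl_def Ws_def T_def)
      define \<gamma> where "\<gamma> = \<sigma> - (x + length v)"
      have \<gamma>: "0 < \<gamma>" "\<gamma> + (x + length v) = \<sigma>" "\<gamma> \<le> p" "p < \<gamma> + length v" "p - \<gamma> < t a"
        using xv(3,4) v(2) p X(2) unfolding \<gamma>_def by linarith+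
      have "\<sigma> - \<gamma> = x + length v" using \<gamma>(2) by simp
      hence "\<gamma> \<in> D j" using xv(6) \<gamma> \<sigma>Y unfolding D_def \<sigma>_def by auto
      moreover have "\<forall>y<length v. \<gamma> + y < E \<longrightarrow> w ! (\<gamma> + y) = v ! y"
      proof (intro allI impI)
        fix y assume y: "y < length v"
        define z where "z = length v - 1 - y"
        have z: "\<sigma> - 1 - (\<gamma> + y) = x + z" "z < length v" "x + z < length Y" "\<gamma> + y < \<sigma>" "length v - 1 - z = y"
          using y \<gamma>(2) \<sigma>Y unfolding z_def by linarith+
        have "w ! (\<gamma> + y) = rev Y ! (\<sigma> - 1 - (\<gamma> + y))"
          using border[OF iI(1), of "\<gamma> + y"] z(4) by (simp add: \<sigma>_def)
        also have "\<dots> = rev v ! z" unfolding z(1) using xv(5) z(2,3) by blast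
        also have "\<dots> = v ! y" using z(2,5) by (simp add: rev_nth)
        finally show "w ! (\<gamma> + y) = v ! y" .
      qed
      ultimately show "\<exists>\<gamma>\<in>D j. \<exists>v\<in>Ws. \<gamma> \<le> p \<and> p < \<gamma> + length v \<and> p - \<gamma> < t a \<and>
        (\<forall>y<length v. \<gamma> + y < E \<longrightarrow> w ! (\<gamma> + y) = v ! y)"
        using v(1) \<gamma>(3-5) by blast
    qed
    then obtain q where q: "0 < q" "q < t a" "periodic_on ((!) w) (t a) E q" by blast
    have "3 * t a \<le> t (a + 3)" by (rule t_triple) (use b in auto)
    hence k3: "t a + 2 * q \<le> t (a + 3)" using q by linarith
    have k4: "t (Suc (a + 3)) \<le> E" by (simp add: E_def eval_nat_numeral)
    show False
      by (rule no_run_over_unit[OF _ q(3,1) _ k3 k4]) (use t_less_lengths[of "a + 4"] b in \<open>auto simp: E_def\<close>)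
  qed
  have "card N = card NB + card NG"
  proof -
    have "N = NB \<union> NG" "NB \<inter> NG = {}" "finite NB" "finite NG" by (auto simp: NB_def NG_def N_def)
    thus ?thesis by (metis card_Un_disjoint)
  qed
  thus False using cb cg cW by (simp add: N_def)
qed

lemma not_many_units: "U \<noteq> n * (8 * n + 12)"
proof
  assume "U = n * (8 * n + 12)"
  then obtain a where a: "a + (8 * n + 12) \<le> U"
    "\<forall>v\<in>W. \<not> (t a < length v \<and> length v \<le> t (a + (8 * n + 12)))"
    using scale_gap_exists by blast
  show False
    by (rule no_scale_gap[of "a + 8 * n + 12" a]) (use a in \<open>auto simp: add.assoc not_le\<close>)
qed

end

context overlap_family
begin

text \<open>
  A larger family would supply a scale with \<open>n * (8 * n + 12)\<close> steps: take every
  \<open>(4 * n + 2)\<close>-th overlap length in increasing order.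
\<close>
theorem card_bound: "card I \<le> (4 * n + 2) * (n * (8 * n + 12))"
proof (rule ccontr)
  define \<rho> where "\<rho> = 4 * n + 2"
  define U where "U = n * (8 * n + 12)"
  assume "\<not> ?thesis"
  hence big: "\<rho> * U < card I" by (simp add: \<rho>_def U_def)
  define l where "l = sorted_list_of_set (s ` I)"
  have l: "sorted_wrt (<) l" "set l = s ` I" "length l = card I"
    using finI card_image[OF inj_s] by (auto simp: l_def)
  define t where "t k = l ! (\<rho> * k)" for k
  have idx: "\<rho> * k \<le> \<rho> * U" if "k \<le> U" for k using that by simp
  have t_in: "t k \<in> s ` I" if "k \<le> U" for k
    using idx[OF that] big l(2,3) unfolding t_def by (metis le_less_trans nth_mem)
  have t_unit: "\<rho> \<le> card {i \<in> I. t k \<le> s i \<and> s i < t (Suc k)}" if k: "k < U" for k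
  proof -
    have lt: "\<rho> * k + \<rho> < length l" using idx[of "Suc k"] k big l(3) by simp
    define X where "X = (!) l ` {\<rho> * k..<\<rho> * k + \<rho>}"
    have inj: "inj_on ((!) l) {\<rho> * k..<\<rho> * k + \<rho>}"
      by (rule linorder_inj_onI) (use lt sorted_wrt_nth_less[OF l(1)] in fastforce)+
    have cX: "card X = \<rho>" unfolding X_def using card_image[OF inj] by simp
    have "X \<subseteq> s ` {i \<in> I. t k \<le> s i \<and> s i < t (Suc k)}"
    proof
      fix x assume "x \<in> X"
      then obtain m where m: "x = l ! m" "\<rho> * k \<le> m" "m < \<rho> * k + \<rho>" by (auto simp: X_def)
      have "x \<in> s ` I" using m lt l(2) by (metis less_trans nth_mem)
      moreover have "t k \<le> x"
        using sorted_wrt_nth_less[OF l(1), of "\<rho> * k" m] m lt unfolding t_def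
        by (cases "m = \<rho> * k") (auto intro: less_imp_le)
      moreover have "x < t (Suc k)"
        using sorted_wrt_nth_less[OF l(1), of m "\<rho> * k + \<rho>"] m lt unfolding t_def by (simp add: add.commute)
      ultimately show "x \<in> s ` {i \<in> I. t k \<le> s i \<and> s i < t (Suc k)}" by auto
    qed
    hence "card X \<le> card (s ` {i \<in> I. t k \<le> s i \<and> s i < t (Suc k)})" using finI by (intro card_mono) auto
    also have "\<dots> \<le> card {i \<in> I. t k \<le> s i \<and> s i < t (Suc k)}" using finI by (intro card_image_le) auto
    finally show ?thesis using cX by simp
  qed
  interpret scaled_overlap_family W w Y I s d C K t U
    by unfold_locales (use t_in t_unit in \<open>auto simp: \<rho>_def\<close>)
  show False using not_many_units by (simp add: U_def)
qed

end

section \<open>Left-infinite texts and their parses\<close>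

text \<open>
  A left-infinite text is a function on the natural numbers that counts its letters from the right
  end: \<open>Z 0\<close> is the last letter. Extending it to the right by a word \<open>p\<close> renumbers all letters.
\<close>
definition extend :: "(nat \<Rightarrow> 'a) \<Rightarrow> 'a list \<Rightarrow> nat \<Rightarrow> 'a" where
  "extend Z p = (\<lambda>k. if k < length p then rev p ! k else Z (k - length p))"

definition suf :: "(nat \<Rightarrow> 'a) \<Rightarrow> nat \<Rightarrow> 'a list" where
  "suf Z k = rev (map Z [0..<k])"

lemma extend_Nil [simp]: "extend Z [] = Z"
  by (simp add: extend_def)

lemma extend_extend [simp]: "extend (extend Z p) q = extend Z (p @ q)"
  by (rule ext) (auto simp: extend_def nth_append add.commute)

lemma extend_nth: "k < length p \<Longrightarrow> extend Z p k = rev p ! k"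
  by (simp add: extend_def)

lemma extend_nth_shift: "extend Z p (length p + k) = Z k"
  by (simp add: extend_def)

lemma suf_extend: "k \<le> length p \<Longrightarrow> suf (extend Z p) k = drop (length p - k) p"
  by (rule nth_equalityI) (auto simp: suf_def extend_def rev_nth)

lemma extend_eq_same_length:
  assumes "extend Z p = extend Z' p'" "length p = length p'"
  shows "Z = Z'" "p = p'"
proof -
  show "Z = Z'"
  proof
    fix k show "Z k = Z' k"
      using extend_nth_shift[of Z p k] extend_nth_shift[of Z' p' k] assms by simp
  qed
  have "suf (extend Z p) (length p) = suf (extend Z' p') (length p')" using assms by simp
  thus "p = p'" by (simp add: suf_extend)
qed

lemma extend_eq_longer:
  assumes eq: "extend Z p = extend Z' p'" and le: "length p' \<le> length p"
  obtains q where "p = q @ p'" "Z' = extend Z q"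
proof -
  define q where "q = take (length p - length p') p"
  have p: "p = q @ drop (length p - length p') p" by (simp add: q_def)
  have "extend (extend Z q) (drop (length p - length p') p) = extend Z' p'"
    unfolding extend_extend using eq p by simp
  from extend_eq_same_length[OF this] le p that[of q] show ?thesis by simp
qed

text \<open>
  The coinductive reading makes the parse go on for ever to the left; no left-infinite text
  would satisfy the inductive one.
\<close>
coinductive left_parsable :: "'a list set \<Rightarrow> (nat \<Rightarrow> 'a) \<Rightarrow> bool" for W where
  left_parsable_extend: "left_parsable W Z \<Longrightarrow> v \<in> W \<Longrightarrow> left_parsable W (extend Z v)"

text \<open>
  What can be read after a cut: the last word may be incomplete.
\<close>
definition Pref :: "'a list set \<Rightarrow> 'a list set" where
  "Pref W = {p. \<exists>vs. set vs \<subseteq> W \<and> prefix p (concat vs)}"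

lemma Pref_appendD: "p @ q \<in> Pref W \<Longrightarrow> p \<in> Pref W"
  by (auto simp: Pref_def dest: append_prefixD)

lemma Pref_append: "v \<in> W \<Longrightarrow> p \<in> Pref W \<Longrightarrow> v @ p \<in> Pref W"
proof -
  assume v: "v \<in> W" and "p \<in> Pref W"
  then obtain vs where "set vs \<subseteq> W" "prefix p (concat vs)" by (auto simp: Pref_def)
  hence "set (v # vs) \<subseteq> W" "prefix (v @ p) (concat (v # vs))" using v by auto
  thus ?thesis unfolding Pref_def by blast
qed

lemma Pref_prefix: "v \<in> W \<Longrightarrow> prefix p v \<Longrightarrow> p \<in> Pref W"
  unfolding Pref_def by (intro CollectI exI[of _ "[v]"]) auto

lemma Pref_cases:
  assumes "p @ [c] \<in> Pref W"
  obtains (inside) v q where "v \<in> W" "p = v @ q" "q @ [c] \<in> Pref W"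
  | (cover) v where "v \<in> W" "length p < length v" "take (length p) v = p" "v ! length p = c"
proof -
  obtain vs where vs: "set vs \<subseteq> W" "prefix (p @ [c]) (concat vs)" using assms by (auto simp: Pref_def)
  obtain v vs' where v: "vs = v # vs'" using vs(2) by (cases vs) auto
  have vW: "v \<in> W" "set vs' \<subseteq> W" using vs v by auto
  have pre: "prefix (p @ [c]) (v @ concat vs')" using vs(2) v by simp
  show ?thesis
  proof (cases "length v \<le> length p")
    case True
    have "prefix p (v @ concat vs')" using pre by (rule append_prefixD)
    moreover have "prefix v (v @ concat vs')" by simp
    ultimately have "prefix v p" using True by (metis prefix_length_prefix)
    then obtain q where q: "p = v @ q" by (auto simp: prefix_def)
    have "prefix (q @ [c]) (concat vs')" using pre unfolding q by simp
    thus ?thesis using inside[OF vW(1) q] vW(2) unfolding Pref_def by blast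
  next
    case False
    hence "length (p @ [c]) \<le> length v" by simp
    moreover have "prefix v (v @ concat vs')" by simp
    ultimately have "prefix (p @ [c]) v" using pre by (metis prefix_length_prefix)
    then obtain t where "v = p @ [c] @ t" by (auto simp: prefix_def)
    thus ?thesis using cover[OF vW(1)] by simp
  qed
qed

lemma suf_extend_take:
  assumes "L \<le> length Y" shows "suf (extend Z (Y @ q)) L = drop (length Y + length q - L) (Y @ q)"
  using suf_extend[of L "Y @ q" Z] assms by simp

section \<open>Least branchings\<close>

locale word_set =
  fixes W :: "'a list set" and L :: nat
  assumes finW: "finite W" and neW: "[] \<notin> W" and len: "v \<in> W \<Longrightarrow> L \<le> length v"
begin

text \<open>
  In \<open>extend Z p = extend Z' p'\<close> the two sides are parses of one text, with chosen cuts at the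
  ends of \<open>Z\<close> and \<open>Z'\<close>, at most \<open>M\<close> letters before the branching point. The letters \<open>p\<close> after
  the chosen cut need not stay inside one word, so every cut far enough to the right can play
  this role.
\<close>
definition branching :: "'a list \<Rightarrow> nat \<Rightarrow> bool" where
  "branching u M \<longleftrightarrow> (\<exists>Z p c Z' p' b. left_parsable W Z \<and> left_parsable W Z' \<and> extend Z p = extend Z' p' \<and>
     p @ [c] \<in> Pref W \<and> p' @ [b] \<in> Pref W \<and> c \<noteq> b \<and> length p \<le> M \<and> length p' \<le> M \<and>
     u = suf (extend Z p) L)"

definition least_branching :: "'a list \<Rightarrow> nat \<Rightarrow> bool" where
  "least_branching u M \<longleftrightarrow> branching u M \<and> (\<forall>M'<M. \<not> branching u M')"

lemma least_branching_exists: "branching u M \<Longrightarrow> \<exists>M. least_branching u M"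
  unfolding least_branching_def using exists_least_iff[of "branching u"] by blast

text \<open>
  The form in which minimality is used: two readings that end in \<open>u\<close> and continue differently
  cannot both start from cuts less than \<open>M\<close> letters back.
\<close>
lemma least_branchingD:
  assumes "least_branching u M" "left_parsable W Z" "left_parsable W Z'" "extend Z p = extend Z' p'"
    "p @ [c] \<in> Pref W" "p' @ [b] \<in> Pref W" "c \<noteq> b" "u = suf (extend Z p) L"
  shows "M \<le> length p \<or> M \<le> length p'"
proof (rule ccontr)
  assume h: "\<not> ?thesis"
  have "branching u (max (length p) (length p'))"
    unfolding branching_def using assms(2-8) by (metis max.cobounded1 max.cobounded2)
  thus False using assms(1) h unfolding least_branching_def by auto
qed

lemma last_word:
  assumes "left_parsable W Z"
  obtains Z' v where "Z = extend Z' v" "v \<in> W" "left_parsable W Z'"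
  using assms by (cases rule: left_parsable.cases) auto

text \<open>
  Move the chosen cut of the second parse to the left, word by word, until it meets the chosen
  cut of the first parse or jumps over it; in the second case the word \<open>Y\<close> of the jump contains
  that cut in its interior.
\<close>
lemma crossing_word:
  assumes "left_parsable W Z'" "extend Z p = extend Z' p'" "length p' \<le> length p" "p' @ [b] \<in> Pref W"
  shows "p @ [b] \<in> Pref W \<or> (\<exists>Y r s Z3. Y \<in> W \<and> 0 < s \<and> s \<le> length p \<and> r \<noteq> [] \<and> Y = r @ take s p \<and>
    Z = extend Z3 r \<and> left_parsable W (extend Z (take s p)) \<and> drop s p @ [b] \<in> Pref W)"
  using assms
proof (induction "length p - length p'" arbitrary: Z' p' rule: less_induct)
  case less
  show ?case
  proof (cases "length p' = length p")
    case True
    hence "p = p'" using extend_eq_same_length(2)[of Z p Z' p'] less.prems(2) by simp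
    thus ?thesis using less.prems by simp
  next
    case False
    hence lt: "length p' < length p" using less.prems by simp
    obtain q where q: "p = q @ p'" "Z' = extend Z q"
      using extend_eq_longer[OF less.prems(2,3)] .
    obtain Z3 v where v: "Z' = extend Z3 v" "v \<in> W" "left_parsable W Z3"
      using last_word[OF less.prems(1)] .
    have vl: "0 < length v" using v neW by auto
    have eq: "extend Z q = extend Z3 v" using q v by simp
    show ?thesis
    proof (cases "length v \<le> length q")
      case True
      show ?thesis
      proof (rule less.hyps[of "v @ p'" Z3])
        show "extend Z p = extend Z3 (v @ p')" using less.prems(2) v by simp
        show "length p - length (v @ p') < length p - length p'" using True q vl by (simp del: length_greater_0_conv)
      qed (use v True q less.prems(4) in \<open>auto intro: Pref_append\<close>)
    next
      case False
      then obtain r where r: "v = r @ q" "Z = extend Z3 r" using extend_eq_longer[OF eq[symmetric]] by auto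
      have "left_parsable W (extend Z (take (length q) p))" using less.prems(1) q by simp
      thus ?thesis using v r q lt False less.prems(4)
        by (intro disjI2 exI[of _ v] exI[of _ r] exI[of _ "length q"] exI[of _ Z3]) auto
    qed
  qed
qed

text \<open>
  The parse \<open>\<dots> Y w\<close> branches at position \<open>M\<close> of \<open>w\<close>, and the other parse has a cut at the start
  of \<open>w\<close>, continues with the word \<open>v\<close>, and reads \<open>b\<close> at the branching point. The two
  alternatives are that \<open>v\<close> ends by the branching point or covers it.
\<close>
definition start_type :: "'a list \<Rightarrow> 'a list \<Rightarrow> 'a list \<Rightarrow> nat \<Rightarrow> 'a \<Rightarrow> 'a list \<Rightarrow> bool" where
  "start_type Y w v M b u \<longleftrightarrow> least_branching u M \<and> M < length w \<and> b \<noteq> w ! M \<and>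
     (\<exists>Z. left_parsable W (extend Z Y) \<and> u = suf (extend Z (Y @ take M w)) L) \<and>
     (length v \<le> M \<and> v = take (length v) w \<and> drop (length v) (take M w) @ [b] \<in> Pref W \<or>
      M < length v \<and> take M v = take M w \<and> v ! M = b)"

text \<open>
  The parse \<open>\<dots> Y w\<close> branches at position \<open>M\<close> of \<open>w\<close>, and the other parse has a word \<open>Y'\<close> that
  ends with the first \<open>s\<close> letters of \<open>w\<close> and begins before \<open>w\<close>; it reads \<open>b\<close> at the branching
  point. The text \<open>Z\<close> is what precedes \<open>Y\<close> in the first parse.
\<close>
definition cross_type :: "'a list \<Rightarrow> 'a list \<Rightarrow> 'a list \<Rightarrow> nat \<Rightarrow> nat \<Rightarrow> 'a \<Rightarrow> (nat \<Rightarrow> 'a) \<Rightarrow> 'a list \<Rightarrow> bool" where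
  "cross_type Y w Y' M s b Z u \<longleftrightarrow> least_branching u M \<and> M < length w \<and> b \<noteq> w ! M \<and>
     left_parsable W (extend Z Y) \<and> u = suf (extend Z (Y @ take M w)) L \<and>
     0 < s \<and> s \<le> M \<and> left_parsable W (extend Z (Y @ take s w)) \<and> drop s (take M w) @ [b] \<in> Pref W \<and>
     (\<exists>r Z3. r \<noteq> [] \<and> Y' = r @ take s w \<and> extend Z Y = extend Z3 r)"

text \<open>
  If both parses had their next cut by the branching point, both chosen cuts could be moved
  there, against minimality. So in one of the parses the word after the chosen cut covers the
  branching point, and by minimality that cut is \<open>M\<close> letters back; \<open>crossing_word\<close> compares it
  with the other parse.
\<close>
lemma branching_types:
  assumes "least_branching u M"
  shows "\<exists>Y\<in>W. \<exists>w\<in>W. \<exists>v\<in>W. (\<exists>b. start_type Y w v M b u) \<or> (\<exists>s b Z. cross_type Y w v M s b Z u)"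
proof -
  \<comment> \<open>The parse \<open>Z\<close> is followed by a word \<open>w\<close> that covers the branching point.\<close>
  have main: ?thesis
    if Z: "left_parsable W Z" and w: "w \<in> W" "M < length w" "p = take M w" "w ! M = c"
      and Z': "left_parsable W Z'" and eq: "extend Z p = extend Z' p'" and p': "length p' \<le> length p" "p' @ [b] \<in> Pref W"
      and cb: "c \<noteq> b" and u: "u = suf (extend Z p) L" for Z p c Z' p' b w
  proof -
    obtain Z0 Y where Y: "Z = extend Z0 Y" "Y \<in> W" using last_word[OF Z] by metis
    have len: "length p = M" using w by simp
    have common: "least_branching u M \<and> M < length w \<and> b \<noteq> w ! M \<and>
        left_parsable W (extend Z0 Y) \<and> u = suf (extend Z0 (Y @ take M w)) L"
      using assms Z w cb u Y by auto
    from crossing_word[OF Z' eq p'] show ?thesis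
    proof
      assume "p @ [b] \<in> Pref W"
      then show ?thesis
      proof (cases rule: Pref_cases)
        case (inside v q)
        have "start_type Y w v M b u" unfolding start_type_def
          using common inside len unfolding w(3) by (metis append_eq_conv_conj le_add1 length_append
              take_take min.absorb1)
        thus ?thesis using Y(2) w(1) inside(1) by blast
      next
        case (cover v)
        have "start_type Y w v M b u" unfolding start_type_def
          using common cover len w(3) by metis
        thus ?thesis using Y(2) w(1) cover(1) by blast
      qed
    next
      assume "\<exists>Y r s Z3. Y \<in> W \<and> 0 < s \<and> s \<le> length p \<and> r \<noteq> [] \<and> Y = r @ take s p \<and>
        Z = extend Z3 r \<and> left_parsable W (extend Z (take s p)) \<and> drop s p @ [b] \<in> Pref W"
      then obtain Y' r s Z3 where Y0: "Y' \<in> W" "0 < s" "s \<le> M" "r \<noteq> []" "Y' = r @ take s p"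
        "Z = extend Z3 r" "left_parsable W (extend Z (take s p))" "drop s (take M w) @ [b] \<in> Pref W"
        unfolding len using w(3) by metis
      have "take s p = take s w" using Y0(3) w(3) by simp
      note Y' = Y0[unfolded this]
      have "cross_type Y w Y' M s b Z0 u" unfolding cross_type_def
        using common Y' unfolding Y(1) extend_extend by blast
      thus ?thesis using Y(2) w(1) Y'(1) by blast
    qed
  qed
  \<comment> \<open>The parse with the longer remainder is the first; if both remainders have length \<open>M\<close>,
    either parse may be the one whose word covers the branching point.\<close>
  have step: ?thesis
    if Z: "left_parsable W Z" and Z': "left_parsable W Z'" and eq: "extend Z p = extend Z' p'"
      and p: "p @ [c] \<in> Pref W" "p' @ [b] \<in> Pref W" and cb: "c \<noteq> b"
      and le: "length p' \<le> length p" "length p \<le> M" and u: "u = suf (extend Z p) L" for Z p c Z' p' b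
  proof -
    \<comment> \<open>Moving the first cut one word to the right keeps the branching, so it cannot bring both
      cuts closer than \<open>M\<close>.\<close>
    have red: "M \<le> length p' \<or> M \<le> length q"
      if "v \<in> W" "p = v @ q" "q @ [c] \<in> Pref W" for v q
    proof -
      have "extend (extend Z v) q = extend Z' p'" using eq that by simp
      moreover have "left_parsable W (extend Z v)" using Z that by (intro left_parsable_extend)
      ultimately show ?thesis
        using least_branchingD[OF assms _ Z' _ that(3) p(2) cb] u that by auto
    qed
    from p(1) show ?thesis
    proof (cases rule: Pref_cases)
      case (cover w)
      have "length p = M" using least_branchingD[OF assms Z Z' eq p cb u] le by linarith
      note pM = this
      show ?thesis
        by (rule main[OF Z cover(1) _ _ _ Z' eq le(1) p(2) cb u]) (use pM cover in auto)
    next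
      case (inside v q)
      have vl: "0 < length v" using inside(1) neW by auto
      have l: "length p' = length p" "length p = M" using red[OF inside] arg_cong[OF inside(2), of length, unfolded length_append] le vl by linarith+
      hence e: "Z = Z'" "p = p'" using extend_eq_same_length[OF eq] by auto
      from p(2) show ?thesis
      proof (cases rule: Pref_cases)
        case (cover w)
        show ?thesis
          by (rule main[OF Z' cover(1) _ _ _ Z eq[symmetric] _ p(1) cb[symmetric]])
            (use l cover u e in auto)
      next
        case inside': (inside v' q')
        have "0 < length v'" using inside'(1) neW by auto
        hence "length q < M" "length q' < M"
          using arg_cong[OF inside(2), of length, unfolded length_append]
            arg_cong[OF inside'(2), of length, unfolded length_append] l vl by linarith+
        moreover have "M \<le> length q \<or> M \<le> length q'"
          by (rule least_branchingD[OF assms left_parsable_extend[OF Z inside(1)]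
                left_parsable_extend[OF Z' inside'(1)] _ inside(3) inside'(3) cb])
            (use eq u inside(2) inside'(2) in auto)
        ultimately show ?thesis by linarith
      qed
    qed
  qed
  have "branching u M" using assms by (simp add: least_branching_def)
  then obtain Z p c Z' p' b where h: "left_parsable W Z" "left_parsable W Z'" "extend Z p = extend Z' p'"
     "p @ [c] \<in> Pref W" "p' @ [b] \<in> Pref W" "c \<noteq> b" "length p \<le> M" "length p' \<le> M" "u = suf (extend Z p) L"
    unfolding branching_def by blast
  show ?thesis
  proof (cases "length p' \<le> length p")
    case True
    show ?thesis by (rule step[OF h(1-6) True h(7,9)])
  next
    case False
    show ?thesis
      by (rule step[OF h(2,1) h(3)[symmetric] h(5,4) h(6)[symmetric] _ h(8)]) (use False h(3,9) in auto)
  qed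
qed

text \<open>
  Two letters after the same cut would be a branching with past \<open>u\<close> less than \<open>d\<close> letters after
  the cut. The text \<open>Z\<close> before \<open>Y\<close> need not be the one that realises \<open>u\<close>, because \<open>Y\<close> already
  contains the \<open>L\<close> letters that matter.
\<close>
lemma unique_letter_after_cut:
  assumes u: "least_branching u d" "u = suf (extend Z' (Y @ take d w)) L"
    and Y: "L \<le> length Y" and \<kappa>: "0 < \<kappa>" "\<kappa> \<le> d" "d \<le> length w"
    and Z: "left_parsable W (extend Z (Y @ take \<kappa> w))"
    and e: "drop \<kappa> (take d w) @ [e] \<in> Pref W" "drop \<kappa> (take d w) @ [e'] \<in> Pref W"
  shows "e = e'"
proof (rule ccontr)
  assume ne: "e \<noteq> e'"
  let ?g = "drop \<kappa> (take d w)"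
  have tk: "take \<kappa> w @ ?g = take d w" using \<kappa> by (metis append_take_drop_id min.absorb1 take_take)
  have "u = suf (extend (extend Z (Y @ take \<kappa> w)) ?g) L"
    unfolding extend_extend append.assoc tk using u(2) Y by (simp add: suf_extend_take)
  hence "d \<le> length ?g \<or> d \<le> length ?g"
    by (intro least_branchingD[OF u(1) Z Z refl e ne])
  thus False using \<kappa> by auto
qed

text \<open>
  Suppose \<open>M < M'\<close>. At position \<open>M\<close> the second branching still follows \<open>w\<close>, whereas the first
  reads \<open>b\<close>. If \<open>v\<close> ends by \<open>M\<close>, these are two letters read after the cut at the end of \<open>v\<close>,
  which determinism excludes; if \<open>v\<close> covers \<open>M\<close>, it would have two letters there. Hence
  \<open>M = M'\<close>, and \<open>u\<close> is determined by \<open>Y\<close>, \<open>w\<close> and \<open>M\<close>.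
\<close>
lemma start_type_unique:
  assumes 1: "start_type Y w v M b u" and 2: "start_type Y w v M' b' u'" and Y: "Y \<in> W" "v \<in> W"
  shows "u = u'"
proof -
  have main: "M = M'" if 1: "start_type Y w v M b u" and 2: "start_type Y w v M' b' u'"
    and le: "M \<le> M'" for M M' b b' u u'
  proof (rule ccontr)
    assume "M \<noteq> M'"
    hence lt: "M < M'" using le by simp
    obtain Z where Z: "left_parsable W (extend Z Y)" "u = suf (extend Z (Y @ take M w)) L"
      using 1 unfolding start_type_def by blast
    have lens: "M < length w" "M' < length w" "b \<noteq> w ! M" "least_branching u M"
      using 1 2 unfolding start_type_def by auto
    have v0: "0 < length v" using Y neW by auto
    consider (a) "length v \<le> M" "v = take (length v) w" "drop (length v) (take M w) @ [b] \<in> Pref W"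
      | (b) "M < length v" "take M v = take M w" "v ! M = b"
      using 1 unfolding start_type_def by blast
    thus False
    proof cases
      case a
      have "drop (length v) (take M' w) @ [b'] \<in> Pref W"
        using 2 a lt unfolding start_type_def by auto
      moreover have "drop (length v) (take M' w) =
          (drop (length v) (take M w) @ [w ! M]) @ drop (Suc M) (take M' w)"
      proof -
        have "take M' w = take M w @ [w ! M] @ drop (Suc M) (take M' w)"
          using id_take_nth_drop[of M "take M' w"] lt lens by (simp add: min_def)
        hence "drop (length v) (take M' w) = drop (length v) (take M w @ [w ! M] @ drop (Suc M) (take M' w))"
          by (rule arg_cong)
        thus ?thesis using a(1) lens by simp
      qed
      ultimately have "drop (length v) (take M w) @ [w ! M] \<in> Pref W" by (metis Pref_appendD append.assoc)
      moreover have "left_parsable W (extend Z (Y @ take (length v) w))"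
        using left_parsable_extend[OF Z(1) Y(2)] a(2) by simp
      ultimately have "b = w ! M"
        using unique_letter_after_cut[OF lens(4) Z(2) len[OF Y(1)] v0 a(1) _ _ a(3)] lens by auto
      thus False using lens by simp
    next
      case b
      have "v ! M = w ! M"
      proof (cases "length v \<le> M'")
        case True
        hence "v = take (length v) w" using 2 unfolding start_type_def by auto
        thus ?thesis using b(1) by (metis nth_take)
      next
        case False
        hence "take M' v = take M' w" using 2 unfolding start_type_def by auto
        thus ?thesis using lt by (metis nth_take)
      qed
      thus False using b(3) lens by simp
    qed
  qed
  have "M = M'" using main[OF 1 2] main[OF 2 1] by linarith
  moreover have "u = suf (extend Z (Y @ take M w)) L \<Longrightarrow> u' = suf (extend Z' (Y @ take M w)) L \<Longrightarrow> u = u'" for Z Z'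
    using len[OF Y(1)] by (simp add: suf_extend_take)
  ultimately show ?thesis using 1 2 unfolding start_type_def by auto
qed

section \<open>Counting the branching words\<close>

text \<open>
  The sets \<open>C u\<close> and \<open>K u\<close> contain the cuts of all parses of the text in question, so that they
  are closed under passing to the next cut. The conditions \<open>C_disjoint\<close>, \<open>mismatch\<close> and
  \<open>no_transport\<close> have the same reason: if one fails for different branching words, one of these
  words can be read with two different continuations after cuts that are closer than its least
  branching distance, or the two words are equal after all. The word \<open>u\<close> that branches stays the
  same because its \<open>L\<close> letters lie within \<open>Y\<close> or \<open>Y'\<close> and the letters after it.
\<close>
lemma cross_type_overlap_family:
  fixes I :: "'a list set"
  assumes finI: "finite I" and words: "Y \<in> W" "w \<in> W" "Y' \<in> W"
    and I: "\<And>u. u \<in> I \<Longrightarrow> cross_type Y w Y' (d u) (s u) (b u) (Z u) u"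
  defines "C \<equiv> \<lambda>u. {\<kappa>. s u \<le> \<kappa> \<and> \<kappa> \<le> d u \<and> left_parsable W (extend (Z u) (Y @ take \<kappa> w)) \<and>
    drop \<kappa> (take (d u) w) @ [b u] \<in> Pref W}"
    and "K \<equiv> \<lambda>u. {x. s u \<le> x \<and> x \<le> length Y' \<and> drop (length Y' - x) Y' \<in> Pref W \<and>
    (\<exists>Z'. left_parsable W Z' \<and> extend Z' (drop (length Y' - x) Y') = extend (Z u) (Y @ take (s u) w))}"
  shows "overlap_family W w Y' I s d C K"
proof -
  define g where "g u \<kappa> = drop \<kappa> (take (d u) w)" for u \<kappa>
  have ct: "least_branching u (d u)" "d u < length w" "b u \<noteq> w ! d u"
      "left_parsable W (extend (Z u) Y)" "u = suf (extend (Z u) (Y @ take (d u) w)) L"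
      "0 < s u" "s u \<le> d u" "left_parsable W (extend (Z u) (Y @ take (s u) w))"
      "g u (s u) @ [b u] \<in> Pref W"
      "\<exists>r Z3. r \<noteq> [] \<and> Y' = r @ take (s u) w \<and> extend (Z u) Y = extend Z3 r" if "u \<in> I" for u
    using I[OF that] unfolding cross_type_def g_def by auto
  have LY: "L \<le> length Y" "L \<le> length Y'" using len words by auto
  have sl: "s u < length Y'" "drop (length Y' - s u) Y' = take (s u) w" if u: "u \<in> I" for u
    using ct(2,7,10)[OF u] by auto
  have split_w: "take \<kappa> w @ g u \<kappa> = take (d u) w" if "\<kappa> \<le> d u" for u \<kappa>
    unfolding g_def using that by (metis append_take_drop_id min.absorb1 take_take)
  have lg: "length (g u \<kappa>) = d u - \<kappa>" if "u \<in> I" for u \<kappa> using ct(2)[OF that] by (simp add: g_def)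
  have gnth: "g u \<kappa> ! y = w ! (\<kappa> + y)" if "u \<in> I" "y < d u - \<kappa>" for u \<kappa> y
    using that ct(2)[OF that(1)] by (simp add: g_def)
  have uY': "\<exists>Z3. extend (Z u) (Y @ take (s u) w) = extend Z3 Y'" if u: "u \<in> I" for u
    using ct(10)[OF u] by (metis extend_extend)
  \<comment> \<open>Through the second parse, \<open>u\<close> is determined by \<open>Y'\<close> and the letters between its end and the
    branching point.\<close>
  have u_suf: "u = drop (length Y' + length (g u (s u)) - L) (Y' @ g u (s u))" if u: "u \<in> I" for u
  proof -
    obtain Z3 where Z3: "extend (Z u) (Y @ take (s u) w) = extend Z3 Y'" using uY'[OF u] by blast
    have "extend (Z u) (Y @ take (d u) w) = extend (extend (Z u) (Y @ take (s u) w)) (g u (s u))"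
      using split_w[OF ct(7)[OF u]] by simp
    also have "\<dots> = extend Z3 (Y' @ g u (s u))" unfolding Z3 by simp
    finally show ?thesis using ct(5)[OF u] suf_extend_take[OF LY(2)] by simp
  qed
  have letter: "e = e'"
    if "u \<in> I" "0 < \<kappa>" "\<kappa> \<le> d u" "v \<in> I" "\<kappa> \<in> C v" "g u \<kappa> @ [e] \<in> Pref W" "g u \<kappa> @ [e'] \<in> Pref W"
    for u v \<kappa> e e'
    by (rule unique_letter_after_cut[of u "d u" "Z u" Y w \<kappa> "Z v"])
      (use that ct[OF that(1)] LY in \<open>auto simp: C_def g_def\<close>)
  have sC: "s u \<in> C u" if "u \<in> I" for u using ct[OF that] by (auto simp: C_def g_def)
  have inj_d: "u = v" if "u \<in> I" "v \<in> I" "d u = d v" for u v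
    using ct(5)[OF that(1)] ct(5)[OF that(2)] that(3) suf_extend_take[OF LY(1)] by metis
  \<comment> \<open>A reading that follows \<open>w\<close> up to a later branching point also reads the letter of \<open>w\<close> at
    \<open>d u\<close>.\<close>
  have g_less: "g u \<kappa> @ [w ! d u] \<in> Pref W" if uv: "u \<in> I" "v \<in> I" and k: "\<kappa> \<le> d u" "d u < d v"
    and pre: "g v \<kappa> @ x \<in> Pref W" for u v \<kappa> x
  proof -
    have "g v \<kappa> = (g u \<kappa> @ [w ! d u]) @ drop (Suc (d u)) (take (d v) w)"
    proof -
      have "take (d v) w = take (d u) w @ [w ! d u] @ drop (Suc (d u)) (take (d v) w)"
        using id_take_nth_drop[of "d u" "take (d v) w"] k ct(2)[OF uv(2)] by (simp add: min_def)
      hence "drop \<kappa> (take (d v) w) = drop \<kappa> (take (d u) w @ [w ! d u] @ drop (Suc (d u)) (take (d v) w))"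
        by (rule arg_cong)
      thus ?thesis using k ct(2)[OF uv(2)] unfolding g_def by simp
    qed
    thus ?thesis using pre by (metis Pref_appendD append.assoc)
  qed
  have mism: "\<exists>y\<le>d u - s u. w ! (s u + y) \<noteq> w ! (s v + y)"
    if uv: "u \<in> I" "v \<in> I" "u \<noteq> v" "s v + (d u - s u) < length w" for u v
  proof (rule ccontr)
    assume "\<not> ?thesis"
    hence eq: "w ! (s u + y) = w ! (s v + y)" if "y \<le> d u - s u" for y using that by blast
    have lu: "length (g u (s u)) = d u - s u" "length (g v (s v)) = d v - s v" using lg uv by auto
    have su: "s u \<le> d u" "s v \<le> d v" using ct(7) uv by auto
    have pos: "0 < s u" "0 < s v" using ct(6) uv by auto
    consider (lt) "d v - s v < d u - s u" | (gt) "d u - s u < d v - s v" | (eq) "d u - s u = d v - s v"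
      by linarith
    thus False
    proof cases
      case lt
      \<comment> \<open>After the end of \<open>Y'\<close> the reading of \<open>u\<close> follows \<open>w\<close> over the branching point of \<open>v\<close>,
        where the reading of \<open>v\<close> has \<open>b v\<close>.\<close>
      define k where "k = d v - s v"
      have "take (Suc k) (g u (s u)) = g v (s v) @ [w ! d v]"
      proof (rule nth_equalityI)
        fix y assume y: "y < length (take (Suc k) (g u (s u)))"
        hence yk: "y \<le> k" "y < d u - s u" using lu by auto
        have "take (Suc k) (g u (s u)) ! y = w ! (s v + y)"
          using yk gnth[OF uv(1)] eq[of y] by simp
        also have "\<dots> = (g v (s v) @ [w ! d v]) ! y"
          using yk lu gnth[OF uv(2), of y "s v"] su by (cases "y = k") (auto simp: nth_append k_def)
        finally show "take (Suc k) (g u (s u)) ! y = (g v (s v) @ [w ! d v]) ! y" .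
      qed (use lt lu in \<open>auto simp: k_def\<close>)
      hence "g v (s v) @ [w ! d v] \<in> Pref W"
        using ct(9)[OF uv(1)] by (metis Pref_appendD append_take_drop_id)
      hence "w ! d v = b v"
        using letter[OF uv(2) pos(2) su(2) uv(2) sC[OF uv(2)]] ct(9)[OF uv(2)] by blast
      thus False using ct(3)[OF uv(2)] by simp
    next
      case gt
      define k where "k = d u - s u"
      have "take (Suc k) (g v (s v)) = g u (s u) @ [w ! d u]"
      proof (rule nth_equalityI)
        fix y assume y: "y < length (take (Suc k) (g v (s v)))"
        hence yk: "y \<le> k" "y < d v - s v" using lu by auto
        have "take (Suc k) (g v (s v)) ! y = w ! (s u + y)"
          using yk gnth[OF uv(2)] eq[of y] by (simp add: k_def)
        also have "\<dots> = (g u (s u) @ [w ! d u]) ! y"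
          using yk lu gnth[OF uv(1), of y "s u"] su by (cases "y = k") (auto simp: nth_append k_def)
        finally show "take (Suc k) (g v (s v)) ! y = (g u (s u) @ [w ! d u]) ! y" .
      qed (use gt lu in \<open>auto simp: k_def\<close>)
      hence "g u (s u) @ [w ! d u] \<in> Pref W"
        using ct(9)[OF uv(2)] by (metis Pref_appendD append_take_drop_id)
      hence "w ! d u = b u"
        using letter[OF uv(1) pos(1) su(1) uv(1) sC[OF uv(1)]] ct(9)[OF uv(1)] by blast
      thus False using ct(3)[OF uv(1)] by simp
    next
      case eq': eq
      have "g u (s u) = g v (s v)"
        by (rule nth_equalityI) (use lu eq' eq gnth[OF uv(1)] gnth[OF uv(2)] in auto)
      thus False using u_suf[OF uv(1)] u_suf[OF uv(2)] uv(3) by metis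
    qed
  qed
  have K_text: "extend (Z u) (Y @ take (s u) w) k = rev Y' ! k" if "u \<in> I" "k < length Y'" for u k
    using uY'[OF that(1)] extend_nth[OF that(2)] by metis
  show ?thesis
  proof
    fix u y assume u: "u \<in> I" and y: "y < s u"
    obtain r where r: "Y' = r @ take (s u) w" using ct(10)[OF u] by blast
    have l: "length (take (s u) w) = s u" using ct(2,7)[OF u] by simp
    have "rev Y' ! (s u - 1 - y) = rev (take (s u) w) ! (s u - 1 - y)"
      unfolding r rev_append using y l by (simp add: nth_append)
    also have "\<dots> = w ! y" using y l by (simp add: rev_nth)
    finally show "w ! y = rev Y' ! (s u - 1 - y)" by simp
  next
    show "inj_on s I"
    proof (rule inj_onI, rule ccontr)
      fix u v assume uv: "u \<in> I" "v \<in> I" "s u = s v" "u \<noteq> v"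
      have main: False if uv: "u \<in> I" "v \<in> I" "s u = s v" "u \<noteq> v" for u v
        using mism[OF uv(1,2,4)] uv(3) ct(2,7)[OF uv(1)] by auto
      show False using main[OF uv] .
    qed
    show "inj_on d I" using inj_d by (auto intro: inj_onI)
  next
    fix u \<kappa> assume u: "u \<in> I" and \<kappa>: "\<kappa> \<in> C u"
    show "s u \<le> \<kappa>" using \<kappa> by (simp add: C_def)
    have \<kappa>': "s u \<le> \<kappa>" "\<kappa> \<le> d u" "left_parsable W (extend (Z u) (Y @ take \<kappa> w))" "g u \<kappa> @ [b u] \<in> Pref W"
      using \<kappa> by (auto simp: C_def g_def)
    from \<kappa>'(4) show "\<exists>v\<in>W. (\<forall>y<length v. \<kappa> + y < d u \<longrightarrow> w ! (\<kappa> + y) = v ! y) \<and>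
        (\<kappa> + length v \<le> d u \<longrightarrow> \<kappa> + length v \<in> C u)"
    proof (cases rule: Pref_cases)
      case (inside v q)
      have lv: "\<kappa> + length v \<le> d u" using lg[OF u, of \<kappa>] inside(2) \<kappa>'(2) by simp
      have agree: "w ! (\<kappa> + y) = v ! y" if "y < length v" for y
        using gnth[OF u, of y \<kappa>] inside(2) that lv by (simp add: nth_append)
      have tk: "take (\<kappa> + length v) w = take \<kappa> w @ v"
      proof -
        have "take (\<kappa> + length v) w = take (\<kappa> + length v) (take (d u) w)" using lv by simp
        also have "\<dots> = take (\<kappa> + length v) (take \<kappa> w @ v @ q)"
          using split_w[OF \<kappa>'(2)] inside(2) by simp
        also have "\<dots> = take \<kappa> w @ v" using \<kappa>'(2) ct(2)[OF u] by simp
        finally show ?thesis .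
      qed
      have "g u (\<kappa> + length v) = q"
      proof -
        have "g u (\<kappa> + length v) = drop (length v) (g u \<kappa>)" by (simp add: g_def add.commute)
        thus ?thesis using inside(2) by simp
      qed
      hence "\<kappa> + length v \<in> C u"
        using lv \<kappa>'(1) inside(3) left_parsable_extend[OF \<kappa>'(3) inside(1)] tk by (simp add: C_def g_def)
      thus ?thesis using inside(1) agree by blast
    next
      case (cover v)
      have "w ! (\<kappa> + y) = v ! y" if "\<kappa> + y < d u" for y
      proof -
        have "y < length (g u \<kappa>)" using that lg[OF u] by simp
        hence "v ! y = g u \<kappa> ! y" using cover(3) by (metis nth_take)
        thus ?thesis using gnth[OF u, of y \<kappa>] that by simp
      qed
      moreover have "\<not> \<kappa> + length v \<le> d u" using cover(2) lg[OF u, of \<kappa>] by simp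
      ultimately show ?thesis using cover(1) by blast
    qed
  next
    fix u v assume uv: "u \<in> I" "v \<in> I" "u \<noteq> v"
    have main: "C u \<inter> C v = {}" if uv: "u \<in> I" "v \<in> I" "d u < d v" for u v
    proof (rule ccontr)
      assume "C u \<inter> C v \<noteq> {}"
      then obtain \<kappa> where \<kappa>: "\<kappa> \<in> C u" "\<kappa> \<in> C v" by blast
      have k: "0 < \<kappa>" "\<kappa> \<le> d u" "g u \<kappa> @ [b u] \<in> Pref W" "g v \<kappa> @ [b v] \<in> Pref W"
        using \<kappa> ct(6)[OF uv(1)] by (auto simp: C_def g_def)
      have "w ! d u = b u"
        by (rule letter[OF uv(1) k(1,2) uv(1) \<kappa>(1) g_less[OF uv(1,2) k(2) uv(3) k(4)] k(3)])
      thus False using ct(3)[OF uv(1)] by simp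
    qed
    have "d u \<noteq> d v" using inj_d uv by blast
    thus "C u \<inter> C v = {}" using main[of u v] main[of v u] uv by (cases "d u < d v") auto
  next
    fix u assume u: "u \<in> I"
    have "take (s u) w \<in> Pref W" using words(2) by (rule Pref_prefix) (rule take_is_prefix)
    moreover have "extend (extend (Z u) Y) (take (s u) w) = extend (Z u) (Y @ take (s u) w)" by simp
    ultimately show "s u \<in> K u" using sl[OF u] ct(4)[OF u] unfolding K_def by fastforce
  next
    fix u x assume u: "u \<in> I" and x: "x \<in> K u"
    show "s u \<le> x" using x by (simp add: K_def)
    define q where "q = drop (length Y' - x) Y'"
    obtain Z' where Z': "left_parsable W Z'" "extend Z' q = extend (Z u) (Y @ take (s u) w)"
      and x': "s u \<le> x" "x \<le> length Y'" "q \<in> Pref W" using x unfolding K_def q_def by blast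
    have lq: "length q = x" using x' by (simp add: q_def)
    obtain Z'' v where v: "Z' = extend Z'' v" "v \<in> W" "left_parsable W Z''" using last_word[OF Z'(1)] .
    have eq: "extend Z'' (v @ q) = extend (Z u) (Y @ take (s u) w)" using Z'(2) v(1) by simp
    have "rev Y' ! (x + y) = rev v ! y" if y: "y < length v" "x + y < length Y'" for y
    proof -
      have "rev Y' ! (x + y) = extend Z'' (v @ q) (x + y)" using K_text[OF u y(2)] eq by simp
      also have "\<dots> = rev v ! y" using y lq by (simp add: extend_def nth_append)
      finally show ?thesis .
    qed
    moreover have "x + length v \<in> K u" if le: "x + length v \<le> length Y'"
    proof -
      obtain Z3 where "extend (Z u) (Y @ take (s u) w) = extend Z3 Y'" using uY'[OF u] by blast
      hence "extend Z3 Y' = extend Z'' (v @ q)" using eq by simp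
      moreover have "length (v @ q) \<le> length Y'" using le lq by simp
      ultimately obtain r where "Y' = r @ v @ q" using extend_eq_longer by metis
      hence "drop (length Y' - (x + length v)) Y' = v @ q" using lq by simp
      moreover have "v @ q \<in> Pref W" using Pref_append v(2) x'(3) by blast
      ultimately show ?thesis unfolding K_def using le x'(1) v(3) eq by auto
    qed
    ultimately show "\<exists>v\<in>W. (\<forall>y<length v. x + y < length Y' \<longrightarrow> rev Y' ! (x + y) = rev v ! y) \<and>
        (x + length v \<le> length Y' \<longrightarrow> x + length v \<in> K u)" using v(2) by blast
  next
    \<comment> \<open>After the cut at \<open>\<gamma>\<close>, the prefix of \<open>w\<close> of length \<open>s j\<close> is readable, hence \<open>w\<close> up to and
      including position \<open>d i\<close>; in the text of \<open>l\<close>, where there is such a cut inside \<open>Y'\<close>, this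
      competes at \<open>d i\<close> with the letter \<open>b i\<close> read after the end of \<open>Y'\<close>.\<close>
    fix i j k l \<gamma>
    assume I4: "i \<in> I" "j \<in> I" "k \<in> I" "l \<in> I" and lt: "d i < s j" and \<gamma>: "0 < \<gamma>" "\<gamma> \<le> s i"
      and Kk: "s j - \<gamma> \<in> K k" and Kl: "s i - \<gamma> \<in> K l"
    have le: "s i \<le> d i" "\<gamma> \<le> s j" using ct(7)[OF I4(1)] \<gamma> lt by auto
    have dropY: "drop (length Y' - (s m - \<gamma>)) Y' = drop \<gamma> (take (s m) w)" if "m \<in> I" "\<gamma> \<le> s m" for m
    proof -
      have "drop (length Y' - (s m - \<gamma>)) Y' = drop \<gamma> (drop (length Y' - s m) Y')"
        using that sl(1)[OF that(1)] by (simp add: add.commute)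
      thus ?thesis using sl(2)[OF that(1)] by simp
    qed
    have "drop \<gamma> (take (s j) w) \<in> Pref W" using Kk dropY[OF I4(2) le(2)] by (simp add: K_def)
    moreover have "drop \<gamma> (take (s j) w) = (g i \<gamma> @ [w ! d i]) @ drop (Suc (d i)) (take (s j) w)"
    proof -
      have sjw: "s j < length w" using ct(2,7)[OF I4(2)] by simp
      have "take (s j) w = take (d i) w @ [w ! d i] @ drop (Suc (d i)) (take (s j) w)"
        using id_take_nth_drop[of "d i" "take (s j) w"] lt sjw by (simp add: min_def)
      hence "drop \<gamma> (take (s j) w) = drop \<gamma> (take (d i) w @ [w ! d i] @ drop (Suc (d i)) (take (s j) w))"
        by (rule arg_cong)
      thus ?thesis using lt \<gamma> le sjw unfolding g_def by simp
    qed
    ultimately have c: "g i \<gamma> @ [w ! d i] \<in> Pref W" by (metis Pref_appendD append.assoc)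
    define q where "q = drop \<gamma> (take (s i) w)"
    have gq: "g i \<gamma> = q @ g i (s i)"
    proof -
      have "drop \<gamma> (take (s i) w @ g i (s i)) = drop \<gamma> (take (d i) w)"
        using split_w[OF le(1)] by simp
      thus ?thesis using \<gamma> le ct(2)[OF I4(1)] unfolding g_def q_def by simp
    qed
    obtain Z' where Z': "left_parsable W Z'" "extend Z' q = extend (Z l) (Y @ take (s l) w)"
      using Kl dropY[OF I4(1) \<gamma>(2)] unfolding K_def q_def by auto
    obtain Z3 where Z3: "extend (Z l) (Y @ take (s l) w) = extend Z3 Y'" using uY'[OF I4(4)] by blast
    have "d i \<le> length (q @ g i (s i)) \<or> d i \<le> length (g i (s i))"
    proof (rule least_branchingD[OF ct(1)[OF I4(1)] Z'(1)])
      show "left_parsable W (extend (Z l) (Y @ take (s l) w))" by (rule ct(8)[OF I4(4)])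
      show "extend Z' (q @ g i (s i)) = extend (extend (Z l) (Y @ take (s l) w)) (g i (s i))"
        unfolding Z'(2)[symmetric] by simp
      show "(q @ g i (s i)) @ [w ! d i] \<in> Pref W" using c gq by simp
      show "g i (s i) @ [b i] \<in> Pref W" by (rule ct(9)[OF I4(1)])
      show "w ! d i \<noteq> b i" using ct(3)[OF I4(1)] by simp
      have "extend Z' (q @ g i (s i)) = extend Z3 (Y' @ g i (s i))"
        using Z'(2) Z3 by (metis extend_extend)
      thus "i = suf (extend Z' (q @ g i (s i))) L"
        using u_suf[OF I4(1)] suf_extend_take[OF LY(2)] by simp
    qed
    moreover have "length (q @ g i (s i)) = d i - \<gamma>" using lg[OF I4(1), of \<gamma>] gq by simp
    moreover have "length (g i (s i)) = d i - s i" by (rule lg[OF I4(1)])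
    ultimately show False using \<gamma> le ct(6)[OF I4(1)] by linarith
  qed (use finW neW words finI ct sl sC mism in auto)
qed

lemma cross_type_card:
  assumes "finite F" "Y \<in> W" "w \<in> W" "Y' \<in> W"
  shows "card {u \<in> F. \<exists>M s b Z. cross_type Y w Y' M s b Z u} \<le>
    (4 * card W + 2) * (card W * (8 * card W + 12))"
proof -
  define I where "I = {u \<in> F. \<exists>M s b Z. cross_type Y w Y' M s b Z u}"
  \<comment> \<open>Choose one branching for each word.\<close>
  have "\<forall>u. \<exists>x. u \<in> I \<longrightarrow>
      cross_type Y w Y' (fst x) (fst (snd x)) (fst (snd (snd x))) (snd (snd (snd x))) u"
  proof
    fix u
    show "\<exists>x. u \<in> I \<longrightarrow>
      cross_type Y w Y' (fst x) (fst (snd x)) (fst (snd (snd x))) (snd (snd (snd x))) u"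
    proof (cases "u \<in> I")
      case True
      then obtain M s b Z where "cross_type Y w Y' M s b Z u" unfolding I_def by blast
      thus ?thesis by (intro exI[of _ "(M, s, b, Z)"]) simp
    qed simp
  qed
  from choice[OF this] obtain f where f: "\<And>u. u \<in> I \<Longrightarrow>
      cross_type Y w Y' (fst (f u)) (fst (snd (f u))) (fst (snd (snd (f u)))) (snd (snd (snd (f u)))) u"
    by blast
  have "finite I" using assms(1) by (simp add: I_def)
  from overlap_family.card_bound[OF cross_type_overlap_family[OF this assms(2-4) f]]
  show ?thesis unfolding I_def[symmetric] .
qed

text \<open>
  With \<open>n\<close> words, each of the \<open>n ^ 3\<close> triples contributes at most one word of the first kind and
  \<open>(4 * n + 2) * (n * (8 * n + 12))\<close> words of the second kind.
\<close>
theorem branching_card: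
  assumes F: "finite F" and br: "\<And>u. u \<in> F \<Longrightarrow> \<exists>M. branching u M"
  shows "card F \<le> 121 * card W ^ 6"
proof -
  define n where "n = card W"
  define m where "m = (4 * n + 2) * (n * (8 * n + 12))"
  define A where "A = (\<lambda>(Y, w, v). {u \<in> F. \<exists>M b. start_type Y w v M b u})"
  define B where "B = (\<lambda>(Y, w, v). {u \<in> F. \<exists>M s b Z. cross_type Y w v M s b Z u})"
  define T where "T = W \<times> W \<times> W"
  have finT: "finite T" using finW by (simp add: T_def)
  have cT: "card T = n ^ 3" by (simp add: T_def n_def card_cartesian_product power3_eq_cube)
  have "F \<subseteq> (\<Union>x\<in>T. A x) \<union> (\<Union>x\<in>T. B x)"
  proof
    fix u assume u: "u \<in> F"
    then obtain M where "least_branching u M" using br least_branching_exists by blast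
    then obtain Y w v where W: "Y \<in> W" "w \<in> W" "v \<in> W"
      and c: "(\<exists>b. start_type Y w v M b u) \<or> (\<exists>s b Z. cross_type Y w v M s b Z u)"
      using branching_types[of u M] by blast
    have "(Y, w, v) \<in> T" using W by (simp add: T_def)
    moreover have "u \<in> A (Y, w, v) \<or> u \<in> B (Y, w, v)" using c u unfolding A_def B_def by blast
    ultimately show "u \<in> (\<Union>x\<in>T. A x) \<union> (\<Union>x\<in>T. B x)" by blast
  qed
  moreover have "(\<Union>x\<in>T. A x) \<union> (\<Union>x\<in>T. B x) \<subseteq> F" by (auto simp: A_def B_def)
  ultimately have "card F = card ((\<Union>x\<in>T. A x) \<union> (\<Union>x\<in>T. B x))" by (metis subset_antisym)
  also have "\<dots> \<le> card (\<Union>x\<in>T. A x) + card (\<Union>x\<in>T. B x)" by (rule card_Un_le)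
  also have "card (\<Union>x\<in>T. A x) \<le> (\<Sum>x\<in>T. card (A x))" by (rule card_UN_le[OF finT])
  also have "(\<Sum>x\<in>T. card (A x)) \<le> (\<Sum>x\<in>T. 1)"
  proof (rule sum_mono)
    fix x assume "x \<in> T"
    then obtain Y w v where x: "x = (Y, w, v)" "Y \<in> W" "v \<in> W" by (auto simp: T_def)
    have "finite (A x)" using F by (simp add: A_def x)
    moreover have "u = u'" if "u \<in> A x" "u' \<in> A x" for u u'
      using that start_type_unique[OF _ _ x(2,3)] unfolding A_def x(1) by blast
    ultimately show "card (A x) \<le> 1" by (simp add: card_le_Suc0_iff_eq)
  qed
  also have "card (\<Union>x\<in>T. B x) \<le> (\<Sum>x\<in>T. card (B x))" by (rule card_UN_le[OF finT])
  also have "(\<Sum>x\<in>T. card (B x)) \<le> (\<Sum>x\<in>T. m)"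
  proof (rule sum_mono)
    fix x assume "x \<in> T"
    then obtain Y w v where x: "x = (Y, w, v)" "Y \<in> W" "w \<in> W" "v \<in> W" by (auto simp: T_def)
    show "card (B x) \<le> m" using cross_type_card[OF F x(2-4)] unfolding B_def x(1) m_def n_def by simp
  qed
  finally have "card F \<le> n ^ 3 * (1 + m)" by (simp add: cT algebra_simps)
  also have "\<dots> \<le> 121 * n ^ 6"
  proof (cases "n = 0")
    case False
    hence n: "1 \<le> n" by simp
    have p: "n ^ i \<le> n ^ 3" if "i \<le> 3" for i using n that by (rule power_increasing[rotated])
    have "1 + m = 32 * n ^ 3 + 64 * n ^ 2 + 24 * n ^ 1 + n ^ 0"
      unfolding m_def by (simp add: algebra_simps power2_eq_square power3_eq_cube)
    also have "\<dots> \<le> 121 * n ^ 3" using p[of 2] p[of 1] p[of 0] by linarith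
    finally have "n ^ 3 * (1 + m) \<le> n ^ 3 * (121 * n ^ 3)" by (rule mult_le_mono2)
    also have "\<dots> = 121 * (n ^ 3 * n ^ 3)" by (simp only: mult.left_commute)
    also have "n ^ 3 * n ^ 3 = n ^ 6" by (simp flip: power_add)
    finally show ?thesis .
  qed simp
  finally show ?thesis by (simp add: n_def)
qed

end

section \<open>From two-sided sequences to parses\<close>

text \<open>
  The letters before position \<open>e\<close>, numbered from right to left as in \<^const>\<open>extend\<close>.
\<close>
definition past :: "(int \<Rightarrow> 'a) \<Rightarrow> int \<Rightarrow> nat \<Rightarrow> 'a" where
  "past x e = (\<lambda>j. x (e - 1 - int j))"

lemma past_factor:
  assumes "e' \<le> e"
  shows "past x e = extend (past x e') (factor x e' e)"
proof
  fix j
  have len: "length (factor x e' e) = nat (e - e')" by (simp add: factor_def)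
  show "past x e j = extend (past x e') (factor x e' e) j"
  proof (cases "j < nat (e - e')")
    case True
    have "rev (factor x e' e) ! j = factor x e' e ! (nat (e - e') - 1 - j)"
      using True len by (simp add: rev_nth)
    also have "\<dots> = x (e' + int (nat (e - e') - 1 - j))"
      unfolding factor_def using True by (subst nth_map) (auto simp: nth_upto)
    also have "e' + int (nat (e - e') - 1 - j) = e - 1 - int j" using True by linarith
    finally show ?thesis using True len by (simp add: past_def extend_def)
  next
    case False
    hence "e' - 1 - int (j - nat (e - e')) = e - 1 - int j" using assms by linarith
    hence "past x e j = past x e' (j - nat (e - e'))" unfolding past_def by (simp only:)
    thus ?thesis using False len unfolding extend_def by simp
  qed
qed

lemma suf_past: "suf (past x 0) L = factor x (- int L) 0"
  using suf_extend[of L "factor x (- int L) 0" "past x (- int L)"] past_factor[of "- int L" 0 x]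
  by (simp add: factor_def)

lemma length_le_length_concat: "[] \<notin> set vs \<Longrightarrow> length vs \<le> length (concat vs)"
proof (induction vs)
  case (Cons v vs)
  hence "1 \<le> length v" by (cases v) auto
  thus ?case using Cons by simp
qed simp

lemma left_parsable_past:
  assumes y: "range y \<subseteq> W" and l: "left_concat_at x k y"
  shows "left_parsable W (past x (k - int (length (concat (map y [- int n..- 1])))))"
proof -
  \<comment> \<open>The words to the left of the cut, taken off one at a time.\<close>
  define u where "u n = concat (map y [- int n..- 1])" for n :: nat
  have pu: "past x k = extend (past x (k - int (length (u n)))) (u n)" for n
    using past_factor[of "k - int (length (u n))" k x] l
    unfolding left_concat_at_def Let_def u_def[symmetric] by simp
  have u_Suc: "u (Suc n) = y (- int (Suc n)) @ u n" for n
  proof -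
    have "[- int (Suc n)..- 1] = - int (Suc n) # [- int n..- 1]"
      using upto_rec1[of "- int (Suc n)" "- 1"] by simp
    thus ?thesis unfolding u_def by simp
  qed
  have step: "past x (k - int (length (u n))) =
      extend (past x (k - int (length (u (Suc n))))) (y (- int (Suc n)))" for n
  proof (rule extend_eq_same_length(1)[of _ "u n" _ "u n"])
    show "extend (past x (k - int (length (u n)))) (u n) =
      extend (extend (past x (k - int (length (u (Suc n))))) (y (- int (Suc n)))) (u n)"
      unfolding extend_extend u_Suc[symmetric] pu[symmetric] ..
  qed simp
  have "left_parsable W (past x (k - int (length (u n))))"
  proof (coinduction arbitrary: n)
    case left_parsable
    show ?case using step[of n] y by blast
  qed
  thus ?thesis unfolding u_def .
qed

text \<open>
  Some cut lies at or before position \<open>0\<close>, and the word sequence from this cut on reaches beyond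
  \<open>0\<close>. If the origin \<open>k\<close> of the factorization is not positive, it is such a cut; otherwise move
  \<open>k\<close> words to the left, which is far enough as the words are nonempty.
\<close>
lemma factorizable_state:
  assumes "factorizable W x" and ne: "[] \<notin> W"
  obtains (state) Z p where "left_parsable W Z" "past x 0 = extend Z p" "p @ [x 0] \<in> Pref W"
proof -
  obtain y k where y: "range y \<subseteq> W" and r: "right_concat_at x k y" and l: "left_concat_at x k y"
    using assms(1) unfolding factorizable_def by blast
  have yW: "y i \<in> W" for i using y by blast
  have ynil: "[] \<noteq> y i" for i using yW[of i] ne by metis
  have reading: thesis
    if h: "k' \<le> 0" "left_parsable W (past x k')" "set vs \<subseteq> W" "factor x k' e = concat vs" "1 \<le> e" for k' vs e
  proof (rule state[OF h(2) past_factor[OF h(1)]])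
    have "factor x k' 0 @ [x 0] = map x [k'..0]"
      using h(1) upto_rec2[of k' 0] by (simp add: factor_def)
    moreover have "[k'..e - 1] = [k'..0] @ [0 + 1..e - 1]" using h(1,5) by (intro upto_split2) auto
    ultimately have "concat vs = (factor x k' 0 @ [x 0]) @ map x [0 + 1..e - 1]"
      using h(4) unfolding factor_def by (metis map_append)
    hence "prefix (factor x k' 0 @ [x 0]) (concat vs)" by (rule prefixI)
    thus "factor x k' 0 @ [x 0] \<in> Pref W" using h(3) unfolding Pref_def by blast
  qed
  show thesis
  proof (cases "k \<le> 0")
    case True
    define n where "n = nat (1 - k)"
    define vs where "vs = map y [0..int n - 1]"
    have "length vs = n" by (simp add: vs_def)
    moreover have "[] \<notin> set vs" using ynil by (auto simp: vs_def)
    ultimately have "n \<le> length (concat vs)" using length_le_length_concat by blast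
    hence e: "1 \<le> k + int (length (concat vs))" using True unfolding n_def by linarith
    have "factor x k (k + int (length (concat vs))) = concat vs"
      using r unfolding right_concat_at_def Let_def vs_def by blast
    moreover have "left_parsable W (past x k)" using left_parsable_past[OF y l, of 0] by simp
    moreover have "set vs \<subseteq> W" using yW by (auto simp: vs_def)
    ultimately show thesis using reading[OF True _ _ _ e] by blast
  next
    case False
    define n where "n = nat k"
    define vs where "vs = map y [- int n..- 1]"
    have "length vs = n" by (simp add: vs_def)
    moreover have "[] \<notin> set vs" using ynil by (auto simp: vs_def)
    ultimately have "n \<le> length (concat vs)" using length_le_length_concat by blast
    hence k': "k - int (length (concat vs)) \<le> 0" unfolding n_def by linarith
    have "factor x (k - int (length (concat vs))) k = concat vs"
      using l unfolding left_concat_at_def Let_def vs_def by blast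
    moreover have "left_parsable W (past x (k - int (length (concat vs))))"
      using left_parsable_past[OF y l, of n] unfolding vs_def .
    moreover have "set vs \<subseteq> W" using yW by (auto simp: vs_def)
    ultimately show thesis using reading[OF k'] False by force
  qed
qed

theorem theorem1p2:
  fixes A :: "'a set" and W :: "'a list set"
  assumes "finite A"
    and "finite W" and "W \<noteq> {}" and "W \<subseteq> nonempty_words A"
  shows "\<exists>B. B \<subseteq> words A (min_length W) \<and> card B \<le> 122 * card W ^ 7 \<and>
    (\<forall>x x'. range x \<subseteq> A \<longrightarrow> range x' \<subseteq> A \<longrightarrow>
       factorizable W x \<longrightarrow> factorizable W x' \<longrightarrow>
       (\<forall>i<0. x i = x' i) \<longrightarrow> x 0 \<noteq> x' 0 \<longrightarrow>
       factor x (- int (min_length W)) 0 \<in> B)"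
proof -
  define L where "L = min_length W"
  have ne: "[] \<notin> W" using assms(4) by (auto simp: nonempty_words_def)
  interpret word_set W L
    using assms(2) ne by unfold_locales (auto simp: L_def min_length_def)
  define B where "B = {u \<in> words A L. \<exists>M. branching u M}"
  have "finite (words A L)" unfolding words_def by (rule finite_lists_length_eq[OF assms(1)])
  hence "finite B" by (simp add: B_def)
  hence "card B \<le> 121 * card W ^ 6" by (rule branching_card) (simp add: B_def)
  also have "\<dots> \<le> 122 * card W ^ 7"
    using assms(2,3) by (intro mult_le_mono power_increasing) (auto simp: Suc_le_eq card_gt_0_iff)
  finally have "card B \<le> 122 * card W ^ 7" .
  moreover have "factor x (- int L) 0 \<in> B"
    if h: "range x \<subseteq> A" "factorizable W x" "factorizable W x'" "\<forall>i<0. x i = x' i" "x 0 \<noteq> x' 0" for x x'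
  proof -
    obtain Z p where Z: "left_parsable W Z" "past x 0 = extend Z p" "p @ [x 0] \<in> Pref W"
      using factorizable_state[OF h(2) ne] .
    obtain Z' p' where Z': "left_parsable W Z'" "past x' 0 = extend Z' p'" "p' @ [x' 0] \<in> Pref W"
      using factorizable_state[OF h(3) ne] .
    have "past x 0 = past x' 0" using h(4) by (auto simp: past_def)
    hence "extend Z p = extend Z' p'" using Z(2) Z'(2) by simp
    moreover have "factor x (- int L) 0 = suf (extend Z p) L" using suf_past[of x L] Z(2) by simp
    ultimately have "branching (factor x (- int L) 0) (max (length p) (length p'))"
      unfolding branching_def using Z(1,3) Z'(1,3) h(5) by (metis max.cobounded1 max.cobounded2)
    moreover have "factor x (- int L) 0 \<in> words A L"
      using h(1) by (auto simp: words_def factor_def)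
    ultimately show ?thesis by (auto simp: B_def)
  qed
  ultimately show ?thesis
    by (intro exI[of _ B]) (auto simp: B_def L_def)
qed

end
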